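(* Let $\Omega\neq\emptyset$ be a compact metric space, let $T:\Omega\to\Omega$ be a homeomorphism, let $l\in\mathbb{N}$, and let $D,V:\Omega\to M(l,\mathbb{R})$ be continuous maps such that $D(\omega)$ and $V(\omega)$ are symmetric and $D(\omega)$ is invertible for each $\omega\in\Omega$. Let $z\in\mathbb{C}$ and let $(T,A(z,\cdot))$ be the $SL(2l,\mathbb{C})$-cocycle with $$A(z,\omega)=\begin{bmatrix} D(T\omega)^{-1}(z-V(T\omega)) & -D(T\omega)^{-1}\\ D(T\omega) & 0\end{bmatrix}.$$ Then $(T,A(z,\cdot))\in\mathcal{UG}$ if, and only if, $(T,A(z,\cdot))\in\mathcal{UH}$.
   Context: $M(l,\mathbb{R})$ is the space of $l\times l$ real matrices. $\mathbb{N}=\{1,2,\dots\}$. An $SL(2l,\mathbb{C})$-cocycle over a compact metric space $\Omega$ is a pair $(T,A)$, where $T:\Omega\to\Omega$ is a homeomorphism and $A:\Omega\to SL(2l,\mathbb{C})$ is continuous, acting on $\Omega\times\mathbb{C}^{2l}$ by $(\omega,\mathbf{u})\mapsto(T\omega,A(\omega)\mathbf{u})$. Its iterates are given by $A_n(\omega)=A(T^{n-1}\omega)\cdots A(T\omega)A(\omega)$ for $n\ge1$, $A_0(\omega)=\mathbb{I}_{2l}$, and $A_n(\omega)=A(T^{n}\omega)^{-1}\cdots A(T^{-2}\omega)^{-1}A(T^{-1}\omega)^{-1}$ for $n\le-1$. Uniform exponential growth: $(T,A)\in\mathcal{UG}$ if there exist constants $\beta>0$ and $\lambda>1$ such that for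 each $\omega\in\Omega$ and each $\mathbf{v}\in\mathbb{C}^{2l}\setminus\{\mathbf{0}\}$, either $\|A_n(\omega)\mathbf{v}\|\ge\beta\lambda^n\|\mathbf{v}\|$ for all $n\in\mathbb{N}$, or $\|A_{-n}(\omega)\mathbf{v}\|\ge\beta\lambda^n\|\mathbf{v}\|$ for all $n\in\mathbb{N}$. Uniform hyperbolicity: $(T,A)\in\mathcal{UH}$ if there exists a continuous Whitney splitting $\mathbb{C}^{2l}\times\Omega=E^s\oplus E^u$ (i.e. continuous subbundles with fibres satisfying $\mathbb{C}^{2l}=E^s(\omega)\oplus E^u(\omega)$ for each $\omega\in\Omega$) such that: (1) $E^s$ and $E^u$ are $(T,A)$-invariant, i.e. for each $\omega\in\Omega$, $j\in\mathbb{Z}$, $\mathbf{v}\in E^u(T^j\omega)$ and $\mathbf{w}\in E^s(T^j\omega)$, one has $A(T^j\omega)\mathbf{v}\in E^u(T^{j+1}\omega)$ and $A(T^j\omega)\mathbf{w}\in E^s(T^{j+1}\omega)$; (2) there exist $C>0$ and $\lambda>1$ such that for each $\omega\in\Omega$, $\mathbf{v}\in E^u(\omega)$, $\mathbf{w}\in E^s(\omega)$ and $n\in\mathbb{N}$, $\|A_{-n}(\omega)\mathbf{v}\|\le C\lambda^{-n}\|\mathbf{v}\|$ and $\|A_n(\omega)\mathbf{w}\|\le C\lambda^{-n}\|\mathbf{w}\|$. *)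

theory Defs
  imports "HOL-Analysis.Analysis"
begin

text \<open>The index type \<^typ>\<open>'l + 'l\<close> has \<open>2l\<close> elements, where \<open>l = CARD('l)\<close>, so
  \<open>complex ^ ('l + 'l)\<close> is \<open>\<complex>\<^sup>2\<^sup>l\<close> with its Euclidean norm, and complex matrices indexed by
  \<open>'l + 'l\<close> split into four blocks indexed by \<open>'l\<close>.\<close>

definition block_matrix ::
  "'a ^ 'l ^ 'l \<Rightarrow> 'a ^ 'l ^ 'l \<Rightarrow> 'a ^ 'l ^ 'l \<Rightarrow> 'a ^ 'l ^ 'l \<Rightarrow> 'a ^ ('l + 'l) ^ ('l + 'l)"
  where
  "block_matrix P Q R S = (\<chi> i j. case i of
      Inl a \<Rightarrow> (case j of Inl b \<Rightarrow> P $ a $ b | Inr b \<Rightarrow> Q $ a $ b)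
    | Inr a \<Rightarrow> (case j of Inl b \<Rightarrow> R $ a $ b | Inr b \<Rightarrow> S $ a $ b))"

definition is_homeomorphism :: "('w::topological_space \<Rightarrow> 'w) \<Rightarrow> bool" where
  "is_homeomorphism T \<longleftrightarrow> (\<exists>S. homeomorphism UNIV UNIV T S)"

definition int_iterate :: "('w \<Rightarrow> 'w) \<Rightarrow> int \<Rightarrow> 'w \<Rightarrow> 'w" where
  "int_iterate T j = (if j \<ge> 0 then T ^^ nat j else inv T ^^ nat (- j))"

definition SL_cocycle ::
  "('w::metric_space \<Rightarrow> 'w) \<Rightarrow> ('w \<Rightarrow> complex ^ 'n ^ 'n) \<Rightarrow> bool" where
  "SL_cocycle T A \<longleftrightarrow>
     is_homeomorphism T \<and> continuous_on UNIV A \<and> (\<forall>\<omega>. det (A \<omega>) = 1)"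

fun forward_iterate ::
  "('w \<Rightarrow> 'w) \<Rightarrow> ('w \<Rightarrow> complex ^ 'n ^ 'n) \<Rightarrow> nat \<Rightarrow> 'w \<Rightarrow> complex ^ 'n ^ 'n" where
  "forward_iterate T A 0 \<omega> = mat 1"
| "forward_iterate T A (Suc n) \<omega> =
     A (int_iterate T (int n) \<omega>) ** forward_iterate T A n \<omega>"

fun backward_iterate ::
  "('w \<Rightarrow> 'w) \<Rightarrow> ('w \<Rightarrow> complex ^ 'n ^ 'n) \<Rightarrow> nat \<Rightarrow> 'w \<Rightarrow> complex ^ 'n ^ 'n" where
  "backward_iterate T A 0 \<omega> = mat 1"
| "backward_iterate T A (Suc n) \<omega> =
     matrix_inv (A (int_iterate T (- int (Suc n)) \<omega>)) ** backward_iterate T A n \<omega>"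

definition cocycle_iterate ::
  "('w \<Rightarrow> 'w) \<Rightarrow> ('w \<Rightarrow> complex ^ 'n ^ 'n) \<Rightarrow> int \<Rightarrow> 'w \<Rightarrow> complex ^ 'n ^ 'n" where
  "cocycle_iterate T A n =
     (if n \<ge> 0 then forward_iterate T A (nat n) else backward_iterate T A (nat (- n)))"

definition UG ::
  "(('w::metric_space \<Rightarrow> 'w) \<times> ('w \<Rightarrow> complex ^ ('l::finite + 'l) ^ ('l + 'l))) set" where
  "UG = {(T, A). SL_cocycle T A \<and>
     (\<exists>\<beta>>0. \<exists>lam>1. \<forall>\<omega>. \<forall>v. v \<noteq> 0 \<longrightarrow>
        (\<forall>n\<ge>1. norm (cocycle_iterate T A (int n) \<omega> *v v) \<ge> \<beta> * lam ^ n * norm v) \<or>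
        (\<forall>n\<ge>1. norm (cocycle_iterate T A (- int n) \<omega> *v v) \<ge> \<beta> * lam ^ n * norm v))}"

text \<open>A family of fibres is a continuous (complex) vector subbundle of the trivial bundle if it
  has, near every point of the base, a frame of continuous sections. The prefix \<open>vec\<close> refers to
  the vector space structure over the complex field (not over the reals).\<close>

definition continuous_subbundle ::
  "('w::topological_space \<Rightarrow> (complex ^ 'n) set) \<Rightarrow> bool" where
  "continuous_subbundle E \<longleftrightarrow>
     (\<forall>\<omega>. \<exists>U (k::nat) f. open U \<and> \<omega> \<in> U \<and>
        (\<forall>i<k. continuous_on U (f i)) \<and>
        (\<forall>x\<in>U. inj_on (\<lambda>i. f i x) {..<k} \<and>
                vec.independent ((\<lambda>i. f i x) ` {..<k}) \<and>
                vec.span ((\<lambda>i. f i x) ` {..<k}) = E x))"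

definition continuous_Whitney_splitting ::
  "('w::topological_space \<Rightarrow> (complex ^ 'n) set) \<Rightarrow> ('w \<Rightarrow> (complex ^ 'n) set) \<Rightarrow> bool" where
  "continuous_Whitney_splitting Es Eu \<longleftrightarrow>
     continuous_subbundle Es \<and> continuous_subbundle Eu \<and>
     (\<forall>\<omega>. {x + y | x y. x \<in> Es \<omega> \<and> y \<in> Eu \<omega>} = UNIV \<and> Es \<omega> \<inter> Eu \<omega> = {0})"

definition UH ::
  "(('w::metric_space \<Rightarrow> 'w) \<times> ('w \<Rightarrow> complex ^ ('l::finite + 'l) ^ ('l + 'l))) set" where
  "UH = {(T, A). SL_cocycle T A \<and>
     (\<exists>Es Eu. continuous_Whitney_splitting Es Eu \<and>
        (\<forall>\<omega>. \<forall>j::int. \<forall>v \<in> Eu (int_iterate T j \<omega>). \<forall>w \<in> Es (int_iterate T j \<omega>).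
           A (int_iterate T j \<omega>) *v v \<in> Eu (int_iterate T (j + 1) \<omega>) \<and>
           A (int_iterate T j \<omega>) *v w \<in> Es (int_iterate T (j + 1) \<omega>)) \<and>
        (\<exists>C>0. \<exists>lam>1. \<forall>\<omega>. \<forall>v \<in> Eu \<omega>. \<forall>w \<in> Es \<omega>. \<forall>n\<ge>1.
           norm (cocycle_iterate T A (- int n) \<omega> *v v) \<le> C * lam powi (- int n) * norm v \<and>
           norm (cocycle_iterate T A (int n) \<omega> *v w) \<le> C * lam powi (- int n) * norm w))}"

definition complex_matrix :: "real ^ 'l ^ 'l \<Rightarrow> complex ^ 'l ^ 'l" where
  "complex_matrix = map_matrix complex_of_real"

definition Jacobi_cocycle ::
  "('w \<Rightarrow> 'w) \<Rightarrow> ('w \<Rightarrow> real ^ 'l ^ 'l) \<Rightarrow> ('w \<Rightarrow> real ^ 'l ^ 'l) \<Rightarrow> complex \<Rightarrow> 'w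
     \<Rightarrow> complex ^ ('l + 'l) ^ ('l + 'l)" where
  "Jacobi_cocycle T D V z \<omega> = block_matrix
     (complex_matrix (matrix_inv (D (T \<omega>))) ** (mat z - complex_matrix (V (T \<omega>))))
     (- complex_matrix (matrix_inv (D (T \<omega>))))
     (complex_matrix (D (T \<omega>)))
     0"

text \<open>\<open>UG\<close> and \<open>UH\<close> contain only \<open>SL\<close>-cocycles by definition; the rest of this theory shows that
  the maps \<open>Jacobi_cocycle T D V z\<close> are such cocycles.\<close>

lemma matrix_inv_of_right_inverse:
  fixes A B :: "'a::field ^ 'n ^ 'n"
  assumes "A ** B = mat 1"
  shows "matrix_inv A = B"
proof -
  have "B ** A = mat 1" using assms matrix_left_right_inverse by blast
  hence "\<exists>A'. A ** A' = mat 1 \<and> A' ** A = mat 1" using assms by blast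
  hence "matrix_inv A ** A = mat 1"
    unfolding matrix_inv_def by (rule someI2_ex) simp
  hence "matrix_inv A ** (A ** B) = B" by (simp add: matrix_mul_assoc)
  thus ?thesis by (simp add: assms)
qed

lemma matrix_inv_right_inverse:
  fixes A :: "'a::field ^ 'n ^ 'n"
  assumes "invertible A"
  shows "A ** matrix_inv A = mat 1"
  using assms matrix_inv_of_right_inverse unfolding invertible_def by metis

lemma matrix_add_rdistrib': "((A::'a::semiring_1^'n^'m) + B) ** C = A ** C + B ** C"
  by (vector matrix_matrix_mult_def sum.distrib[symmetric] field_simps)

lemma matrix_mul_minus_left: "(- A :: 'a::ring_1^'n^'m) ** B = - (A ** B)"
  by (vector matrix_matrix_mult_def sum_negf)

lemma matrix_mul_minus_right: "(A :: 'a::ring_1^'n^'m) ** (- B) = - (A ** B)"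
  by (vector matrix_matrix_mult_def sum_negf)

lemma matrix_mul_zero: "(A :: 'a::ring_1^'n^'m) ** 0 = 0" "0 ** (B :: 'a::ring_1^'n^'m) = 0"
  by (vector matrix_matrix_mult_def)+

lemma block_matrix_mult:
  fixes P Q R S P' Q' R' S' :: "complex ^ 'l ^ 'l"
  shows "block_matrix P Q R S ** block_matrix P' Q' R' S' =
    block_matrix (P ** P' + Q ** R') (P ** Q' + Q ** S') (R ** P' + S ** R') (R ** Q' + S ** S')"
proof -
  have *: "(\<Sum>k\<in>UNIV. h k) = (\<Sum>a\<in>UNIV. h (Inl a)) + (\<Sum>a\<in>UNIV. h (Inr a))"
    for h :: "'l + 'l \<Rightarrow> complex"
    by (simp add: UNIV_Plus_UNIV[symmetric] sum.Plus del: UNIV_Plus_UNIV)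
  show ?thesis
    by (simp add: vec_eq_iff matrix_matrix_mult_def block_matrix_def * split: sum.split)
qed

lemma block_matrix_one: "block_matrix (mat 1) 0 0 (mat 1) = (mat 1 :: complex ^ ('l::finite+'l) ^ ('l+'l))"
  by (simp add: vec_eq_iff mat_def block_matrix_def split: sum.split)

text \<open>A unipotent triangular block matrix is conjugate to its own square.\<close>

lemma det_block_unipotent:
  fixes X :: "complex ^ 'l ^ 'l"
  shows "det (block_matrix (mat 1) X 0 (mat 1)) = 1" (is "det ?U = 1")
    and "det (block_matrix (mat 1) 0 X (mat 1)) = 1" (is "det ?L = 1")
proof -
  let ?S = "block_matrix (mat 2) 0 0 (mat 1) :: complex ^ ('l+'l) ^ ('l+'l)"
  let ?R = "block_matrix (mat (1/2)) 0 0 (mat 1) :: complex ^ ('l+'l) ^ ('l+'l)"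
  have mm: "mat c ** mat d = (mat (c * d) :: complex ^ 'l ^ 'l)" for c d
    by (vector matrix_matrix_mult_def mat_def) (simp add: if_distrib if_distribR cong: if_cong)
  have m2: "mat 2 ** X = X + X" "X ** mat 2 = X + X"
    by (vector matrix_matrix_mult_def mat_def; simp add: if_distrib if_distribR cong: if_cong)+
  note simps = block_matrix_mult block_matrix_one mm m2 matrix_mul_zero
  have SR: "?S ** ?R = mat 1" by (simp add: simps)
  hence dSR: "det ?S * det ?R = 1" by (metis det_I det_mul)
  have "?S ** ?U = (?U ** ?U) ** ?S" by (simp add: simps)
  from arg_cong[OF this, of det]
    have "det ?S * det ?U = det ?U * det ?U * det ?S"
    by (simp only: det_mul)
  moreover have "?U ** block_matrix (mat 1) (- X) 0 (mat 1) = mat 1" by (simp add: simps)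
  hence "det ?U \<noteq> 0"
    by (metis det_I det_mul mult_zero_left zero_neq_one)
  ultimately show "det ?U = 1" using dSR by auto
  have "?L ** ?S = ?S ** (?L ** ?L)" by (simp add: simps)
  from arg_cong[OF this, of det]
    have "det ?L * det ?S = det ?S * (det ?L * det ?L)"
    by (simp only: det_mul)
  moreover have "?L ** block_matrix (mat 1) 0 (- X) (mat 1) = mat 1" by (simp add: simps)
  hence "det ?L \<noteq> 0"
    by (metis det_I det_mul mult_zero_left zero_neq_one)
  ultimately show "det ?L = 1" using dSR by auto
qed

lemma complex_matrix_mult: "complex_matrix (P ** Q) = complex_matrix P ** complex_matrix Q"
  by (simp add: vec_eq_iff complex_matrix_def matrix_matrix_mult_def)

lemma complex_matrix_one: "complex_matrix (mat 1) = mat 1"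
  by (simp add: vec_eq_iff complex_matrix_def mat_def)

lemma det_Jacobi_cocycle:
  assumes "invertible (D (T \<omega>))"
  shows "det (Jacobi_cocycle T D V z \<omega>) = 1"
proof -
  define c where "c = complex_matrix (D (T \<omega>))"
  define b where "b = complex_matrix (matrix_inv (D (T \<omega>)))"
  define Y where "Y = mat z - complex_matrix (V (T \<omega>))"
  have cb: "c ** b = mat 1"
    unfolding c_def b_def
    by (simp add: complex_matrix_mult[symmetric] complex_matrix_one matrix_inv_right_inverse assms)
  hence bc: "b ** c = mat 1" using matrix_left_right_inverse by blast
  let ?U = "block_matrix (mat 1) (- b) 0 (mat 1)"
  have "Jacobi_cocycle T D V z \<omega> =
      ?U ** block_matrix (mat 1) 0 c (mat 1) ** ?U ** block_matrix (mat 1) 0 (- Y) (mat 1)"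
    by (simp add: Jacobi_cocycle_def c_def[symmetric] b_def[symmetric] Y_def[symmetric]
        block_matrix_mult matrix_mul_zero matrix_mul_minus_left matrix_mul_minus_right cb bc)
  thus ?thesis by (simp add: det_mul det_block_unipotent)
qed

lemma continuous_on_det:
  fixes M :: "'w::topological_space \<Rightarrow> real ^ 'n ^ 'n"
  assumes "\<And>i j. continuous_on U (\<lambda>\<omega>. M \<omega> $ i $ j)"
  shows "continuous_on U (\<lambda>\<omega>. det (M \<omega>))"
  unfolding det_def by (intro continuous_intros assms)

lemma continuous_on_matrix_inv:
  fixes M :: "'w::topological_space \<Rightarrow> real ^ 'n ^ 'n"
  assumes M: "continuous_on U M" and inv: "\<And>\<omega>. \<omega> \<in> U \<Longrightarrow> invertible (M \<omega>)"
  shows "continuous_on U (\<lambda>\<omega>. matrix_inv (M \<omega>) $ k $ j)"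
proof -
  have comp: "continuous_on U (\<lambda>\<omega>. M \<omega> $ i $ m)" for i m
    by (intro continuous_intros M)
  let ?N = "\<lambda>\<omega>. \<chi> i m. if m = k then axis j 1 $ i else M \<omega> $ i $ m"
  have "matrix_inv (M \<omega>) $ k $ j = det (?N \<omega>) / det (M \<omega>)" if "\<omega> \<in> U" for \<omega>
  proof -
    have "M \<omega> *v (matrix_inv (M \<omega>) *v axis j 1) = axis j 1"
      by (simp add: matrix_vector_mul_assoc matrix_inv_right_inverse inv that)
    moreover have "det (M \<omega>) \<noteq> 0" using inv[OF that] by (simp add: invertible_det_nz)
    ultimately have "(matrix_inv (M \<omega>) *v axis j 1) $ k = det (?N \<omega>) / det (M \<omega>)"
      using cramer[of "M \<omega>" "matrix_inv (M \<omega>) *v axis j 1" "axis j 1"]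
      by (metis (no_types, lifting) vec_lambda_beta)
    thus ?thesis by (simp add: matrix_vector_mul_component matrix_vector_mult_basis column_def)
  qed
  moreover have "continuous_on U (\<lambda>\<omega>. det (?N \<omega>) / det (M \<omega>))"
  proof (rule continuous_on_divide)
    show "continuous_on U (\<lambda>\<omega>. det (?N \<omega>))"
    proof (rule continuous_on_det)
      show "continuous_on U (\<lambda>\<omega>. ?N \<omega> $ i $ m)" for i m
        by (cases "m = k") (simp_all add: comp)
    qed
    show "continuous_on U (\<lambda>\<omega>. det (M \<omega>))" by (intro continuous_on_det comp)
    show "\<forall>\<omega>\<in>U. det (M \<omega>) \<noteq> 0" using inv by (simp add: invertible_det_nz)
  qed
  ultimately show ?thesis by (simp cong: continuous_on_cong)
qed

lemma SL_cocycle_Jacobi_cocycle: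
  fixes D V :: "'w::metric_space \<Rightarrow> real ^ 'l ^ 'l"
  assumes T: "is_homeomorphism T" and D: "continuous_on UNIV D" and V: "continuous_on UNIV V"
    and inv: "\<And>\<omega>. invertible (D \<omega>)"
  shows "SL_cocycle T (Jacobi_cocycle T D V z)"
proof -
  have cT: "continuous_on UNIV T"
    using T by (auto simp: is_homeomorphism_def homeomorphism_def)
  have comp: "continuous_on UNIV (\<lambda>\<omega>. g (T \<omega>))" if "continuous_on UNIV g"
    for g :: "'w \<Rightarrow> 'b::topological_space"
    using continuous_on_compose2[OF that cT] by simp
  have cD: "continuous_on UNIV (\<lambda>\<omega>. D (T \<omega>) $ i $ j)" for i j
    by (intro continuous_intros comp D)
  have cV: "continuous_on UNIV (\<lambda>\<omega>. V (T \<omega>) $ i $ j)" for i j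
    by (intro continuous_intros comp V)
  have cI: "continuous_on UNIV (\<lambda>\<omega>. matrix_inv (D (T \<omega>)) $ i $ j)" for i j
    by (intro continuous_on_matrix_inv comp D inv)
  have "continuous_on UNIV (\<lambda>\<omega>. Jacobi_cocycle T D V z \<omega> $ i $ j)" for i j
    by (cases i; cases j)
       (auto simp: Jacobi_cocycle_def block_matrix_def complex_matrix_def matrix_matrix_mult_def
         intro!: continuous_intros cD cV cI)
  hence "continuous_on UNIV (\<lambda>\<omega>. \<chi> i j. Jacobi_cocycle T D V z \<omega> $ i $ j)"
    by (intro continuous_on_vec_lambda)
  hence "continuous_on UNIV (Jacobi_cocycle T D V z)"
    by simp
  thus ?thesis using T by (simp add: SL_cocycle_def det_Jacobi_cocycle inv)
qed

end

theory Submission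
  imports Defs
begin

text \<open>The equivalence holds for every continuous cocycle over a compact space that preserves the
  complex symplectic form; the symmetry of \<open>D\<close> and \<open>V\<close> makes the Jacobi cocycle such a cocycle.

  Hyperbolicity implies growth by a standard argument: the invariant splitting has uniformly
  bounded projections (\<open>splitting_bound\<close>), and the larger component of a vector dictates the growth of its
  orbit (\<open>growth_of_splitting\<close>).

  For the converse, let \<open>E\<^sup>s\<close> and \<open>E\<^sup>u\<close> consist of the vectors with bounded forward, respectively
  backward, orbits. Growth makes bounded half-orbits decay exponentially (\<open>stable_space_decay\<close>). Hence
  \<open>E\<^sup>s\<close> and \<open>E\<^sup>u\<close> intersect trivially and have closed graphs, which together with bounded projections
  makes them continuous bundles (\<open>continuous_subbundle_S\<close>). The essential point is that \<open>E\<^sup>s + E\<^sup>u\<close> is the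
  whole space. This fails for general cocycles with growth, and it is here that the symplectic structure
  enters: it identifies the dual cocycle with the cocycle itself up to isometries, so that the dual
  cocycle grows as well. Growth of the dual at the times \<open>N\<close> and \<open>- N\<close> is a lower bound for an adjoint, and
  therefore gives a decomposition \<open>v = s + u\<close> for which \<open>s\<close> at time \<open>N\<close> and \<open>u\<close> at time \<open>- N\<close> are bounded
  (\<open>exists_decomposition_of_adjoint_lower_bound\<close>, \<open>finite_time_decomposition\<close>). Growth of the cocycle bounds
  \<open>s\<close> and \<open>u\<close> on the whole orbit segments, uniformly in \<open>N\<close>
  (\<open>uniform_finite_time_decomposition\<close>), and a limit \<open>N \<rightarrow> \<infinity>\<close> gives \<open>v \<in> E\<^sup>s + E\<^sup>u\<close> (\<open>decomposition\<close>).\<close>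

section \<open>Limits and continuity\<close>

text \<open>Compactness turns uniqueness of the cluster point into convergence; this is how a closed graph
  will yield continuity.\<close>

lemma convergent_of_unique_cluster_point:
  fixes f :: "nat \<Rightarrow> 'a::heine_borel"
  assumes bdd: "bounded (range f)"
    and uniq: "\<And>r m. strict_mono r \<Longrightarrow> (f \<circ> r) \<longlonglongrightarrow> m \<Longrightarrow> m = l"
  shows "f \<longlonglongrightarrow> l"
proof (rule ccontr)
  assume "\<not> f \<longlonglongrightarrow> l"
  then obtain e where e: "e > 0" and far: "\<not> (\<forall>\<^sub>F n in sequentially. dist (f n) l < e)"
    by (auto simp: tendsto_iff)
  define I where "I = {n. e \<le> dist (f n) l}"
  have "infinite I"
    using far unfolding I_def cofinite_eq_sequentially[symmetric] eventually_cofinite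
    by (simp add: not_less)
  hence r: "strict_mono (enumerate I)" "\<And>n. enumerate I n \<in> I"
    by (auto simp: strict_mono_enumerate enumerate_in_set)
  have "bounded (range (f \<circ> enumerate I))"
    using bdd by (rule bounded_subset) auto
  then obtain m q where q: "strict_mono q" "(f \<circ> enumerate I \<circ> q) \<longlonglongrightarrow> m"
    using bounded_imp_convergent_subsequence by blast
  have "m = l"
    using uniq[of "enumerate I \<circ> q" m] q r by (simp add: strict_mono_o o_assoc)
  hence "\<forall>\<^sub>F n in sequentially. dist ((f \<circ> enumerate I \<circ> q) n) l < e"
    using q(2) e by (simp add: tendsto_iff)
  then obtain n where "dist (f (enumerate I (q n))) l < e"
    by (auto simp: eventually_sequentially)
  thus False using r(2)[of "q n"] by (simp add: I_def)
qed

lemma tendsto_matrix_vector_mult: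
  fixes A :: "'a \<Rightarrow> complex ^ 'n ^ 'm"
  assumes "(A \<longlongrightarrow> A') F" "(v \<longlongrightarrow> v') F"
  shows "((\<lambda>x. A x *v v x) \<longlongrightarrow> A' *v v') F"
  unfolding matrix_vector_mult_def
  by (rule vec_tendstoI) (auto intro!: tendsto_intros assms)

lemma continuous_on_matrix_mult:
  fixes A :: "'w::topological_space \<Rightarrow> complex ^ 'n ^ 'm" and B :: "'w \<Rightarrow> complex ^ 'k ^ 'n"
  assumes "continuous_on X A" "continuous_on X B"
  shows "continuous_on X (\<lambda>x. A x ** B x)"
  unfolding matrix_matrix_mult_def
  by (intro continuous_on_vec_lambda continuous_intros assms)

lemma continuous_on_complex_det:
  fixes M :: "'w::topological_space \<Rightarrow> complex ^ 'n ^ 'n"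
  assumes "\<And>i j. continuous_on X (\<lambda>x. M x $ i $ j)"
  shows "continuous_on X (\<lambda>x. det (M x))"
  unfolding det_def by (intro continuous_intros assms)

section \<open>Closed splittings are continuous\<close>

text \<open>The closedness conditions say that \<open>{(x, v). v \<in> S x}\<close> and \<open>{(x, v). v \<in> U x}\<close> are closed in the
  total space. The spaces defined by the growth of orbits satisfy them for free, whereas local frames
  have to be constructed.\<close>

locale closed_splitting =
  fixes S U :: "'w::metric_space \<Rightarrow> (complex ^ 'n) set" and K :: real
  assumes subspace_S: "vec.subspace (S x)" and subspace_U: "vec.subspace (U x)"
    and decomposition: "\<exists>s\<in>S x. v - s \<in> U x"
    and trivial_intersection: "v \<in> S x \<Longrightarrow> v \<in> U x \<Longrightarrow> v = 0"
    and norm_S_le: "s \<in> S x \<Longrightarrow> u \<in> U x \<Longrightarrow> norm s \<le> K * norm (s + u)"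
    and closed_S: "f \<longlonglongrightarrow> x \<Longrightarrow> g \<longlonglongrightarrow> v \<Longrightarrow> (\<And>n. g n \<in> S (f n)) \<Longrightarrow> v \<in> S x"
    and closed_U: "f \<longlonglongrightarrow> x \<Longrightarrow> g \<longlonglongrightarrow> v \<Longrightarrow> (\<And>n. g n \<in> U (f n)) \<Longrightarrow> v \<in> U x"
begin

definition proj :: "'w \<Rightarrow> complex ^ 'n \<Rightarrow> complex ^ 'n" where
  "proj x v = (THE s. s \<in> S x \<and> v - s \<in> U x)"

lemma proj_unique:
  assumes "s \<in> S x" "v - s \<in> U x" "t \<in> S x" "v - t \<in> U x"
  shows "s = t"
proof -
  have "s - t \<in> S x" using assms subspace_S vec.subspace_diff by blast
  moreover have "s - t = (v - t) - (v - s)" by simp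
  hence "s - t \<in> U x" using assms subspace_U vec.subspace_diff by metis
  ultimately show ?thesis using trivial_intersection[of "s - t" x] by simp
qed

lemma proj_eqI: "s \<in> S x \<Longrightarrow> v - s \<in> U x \<Longrightarrow> proj x v = s"
  unfolding proj_def using proj_unique by blast

lemma proj_mem: "proj x v \<in> S x" and diff_proj_mem: "v - proj x v \<in> U x"
  using decomposition[of x v] proj_eqI by metis+

lemma linear_proj: "Vector_Spaces.linear (*s) (*s) (proj x)"
proof (unfold_locales)
  show "proj x (a + b) = proj x a + proj x b" for a b
  proof (rule proj_eqI)
    show "proj x a + proj x b \<in> S x" using proj_mem subspace_S vec.subspace_add by blast
    have "a + b - (proj x a + proj x b) = (a - proj x a) + (b - proj x b)" by simp
    thus "a + b - (proj x a + proj x b) \<in> U x"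
      using diff_proj_mem subspace_U vec.subspace_add by metis
  qed
  show "proj x (c *s a) = c *s proj x a" for a c
  proof (rule proj_eqI)
    show "c *s proj x a \<in> S x" using proj_mem subspace_S vec.subspace_scale by blast
    show "c *s a - c *s proj x a \<in> U x"
      using diff_proj_mem[of a x] subspace_U vec.subspace_scale vec.scale_right_diff_distrib by metis
  qed
qed

lemma norm_proj_le: "norm (proj x v) \<le> K * norm v"
  using norm_S_le[OF proj_mem diff_proj_mem, of x v v] by simp

text \<open>The projections are uniformly bounded, and any cluster point of \<open>proj (f n) v\<close> lies in \<open>S x\<close> and
  differs from \<open>v\<close> by an element of \<open>U x\<close>; uniqueness of the decomposition identifies it.\<close>

lemma continuous_on_proj: "continuous_on X (\<lambda>x. proj x v)"
proof -
  have "(\<lambda>n. proj (f n) v) \<longlonglongrightarrow> proj x v" if f: "f \<longlonglongrightarrow> x" for f x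
  proof (rule convergent_of_unique_cluster_point)
    show "bounded (range (\<lambda>n. proj (f n) v))"
      using norm_proj_le by (auto simp: bounded_iff)
    fix r m assume r: "strict_mono (r :: nat \<Rightarrow> nat)" and m: "((\<lambda>n. proj (f n) v) \<circ> r) \<longlonglongrightarrow> m"
    have fr: "(f \<circ> r) \<longlonglongrightarrow> x" using f r by (rule LIMSEQ_subseq_LIMSEQ)
    have "m \<in> S x" using fr m by (rule closed_S) (simp add: proj_mem)
    moreover have "v - m \<in> U x"
      using fr tendsto_diff[OF tendsto_const m] by (rule closed_U) (simp add: diff_proj_mem)
    ultimately show "m = proj x v" by (simp add: proj_eqI)
  qed
  thus ?thesis
    unfolding continuous_on_sequentially by (auto simp: o_def)
qed

text \<open>With \<open>P\<close> the projection, the matrix \<open>M x = P x P x\<^sub>0 + (1 - P x) (1 - P x\<^sub>0)\<close> is the identity at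
  \<open>x\<^sub>0\<close>, hence invertible for \<open>x\<close> near \<open>x\<^sub>0\<close>, and it maps \<open>S x\<^sub>0\<close> into \<open>S x\<close> and \<open>U x\<^sub>0\<close> into \<open>U x\<close>.
  Applied to a basis of \<open>S x\<^sub>0\<close> it gives a continuous frame of \<open>S\<close>. The frame spans all of \<open>S x\<close>
  because \<open>M x\<close> is surjective and \<open>S x \<inter> U x = {0}\<close>.\<close>

lemma continuous_subbundle_S: "continuous_subbundle S"
  unfolding continuous_subbundle_def
proof
  fix x\<^sub>0
  define f where "f x v = proj x (proj x\<^sub>0 v) + ((v - proj x\<^sub>0 v) - proj x (v - proj x\<^sub>0 v))" for x v
  define M where "M x = matrix (f x)" for x
  have lin: "Vector_Spaces.linear (*s) (*s) (f x)" for x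
  proof -
    interpret p: Vector_Spaces.linear "(*s)" "(*s)" "proj x" by (rule linear_proj)
    interpret q: Vector_Spaces.linear "(*s)" "(*s)" "proj x\<^sub>0" by (rule linear_proj)
    show ?thesis
      by unfold_locales
        (simp_all add: f_def p.add q.add p.diff q.diff p.scale q.scale
          vec.scale_right_diff_distrib vec.scale_right_distrib vec_eq_iff)
  qed
  have M: "M x *v v = f x v" for x v
    unfolding M_def by (rule matrix_works[OF lin])
  have cont: "continuous_on UNIV (\<lambda>x. M x *v v)" for v
    unfolding M f_def by (intro continuous_intros continuous_on_proj)
  have "continuous_on UNIV (\<lambda>x. M x $ i $ j)" for i j
  proof -
    have "continuous_on UNIV (\<lambda>x. (M x *v axis j 1) $ i)"
      by (intro continuous_intros cont)
    moreover have "(M x *v axis j 1) $ i = M x $ i $ j" for x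
      by (simp add: matrix_vector_mult_def axis_def if_distrib cong: if_cong)
    ultimately show ?thesis by simp
  qed
  hence det: "continuous_on UNIV (\<lambda>x. det (M x))" by (rule continuous_on_complex_det)
  define W where "W = {x. det (M x) \<noteq> 0}"
  have "open W"
    using open_Collect_neq[OF det continuous_on_const[of UNIV 0]] by (simp add: W_def)
  have f0: "f x\<^sub>0 v = v" for v
  proof -
    have "proj x\<^sub>0 (v - proj x\<^sub>0 v) = 0"
      by (rule proj_eqI) (simp_all add: subspace_S vec.subspace_0 diff_proj_mem)
    moreover have "proj x\<^sub>0 (proj x\<^sub>0 v) = proj x\<^sub>0 v"
      by (rule proj_eqI) (simp_all add: subspace_U vec.subspace_0 proj_mem)
    ultimately show ?thesis by (simp add: f_def)
  qed
  have "M x\<^sub>0 = mat 1" by (simp add: matrix_eq M f0)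
  hence "x\<^sub>0 \<in> W" by (simp add: W_def)
  have fS: "f x v \<in> S x" if "v \<in> S x\<^sub>0" for x v
  proof -
    have "proj x\<^sub>0 v = v"
      by (rule proj_eqI) (use that subspace_U vec.subspace_0 in auto)
    moreover have "proj x 0 = 0"
      by (rule proj_eqI) (simp_all add: subspace_S subspace_U vec.subspace_0)
    ultimately show ?thesis by (simp add: f_def proj_mem)
  qed
  have fU: "f x v \<in> U x" if "v \<in> U x\<^sub>0" for x v
  proof -
    have "proj x\<^sub>0 v = 0"
      by (rule proj_eqI) (use that subspace_S vec.subspace_0 in auto)
    moreover have "proj x 0 = 0"
      by (rule proj_eqI) (simp_all add: subspace_S subspace_U vec.subspace_0)
    ultimately show ?thesis by (simp add: f_def diff_proj_mem)
  qed
  obtain B where B: "B \<subseteq> S x\<^sub>0" "vec.independent B" "S x\<^sub>0 \<subseteq> vec.span B"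
    by (rule vec.basis_exists)
  have spanB: "vec.span B = S x\<^sub>0"
    using B vec.span_minimal[OF B(1) subspace_S] by (intro subset_antisym)
  have "finite B" using B(2) by (rule vec.finiteI_independent)
  then obtain h where h: "bij_betw h {..<card B} B"
    using ex_bij_betw_nat_finite by (metis atLeast0LessThan)
  have frame: "inj_on (\<lambda>i. f x (h i)) {..<card B} \<and>
      vec.independent ((\<lambda>i. f x (h i)) ` {..<card B}) \<and>
      vec.span ((\<lambda>i. f x (h i)) ` {..<card B}) = S x" if "x \<in> W" for x
  proof -
    interpret fx: Vector_Spaces.linear "(*s)" "(*s)" "f x" by (rule lin)
    have "invertible (M x)" using that by (simp add: W_def invertible_det_nz)
    then obtain N where N: "N ** M x = mat 1" "M x ** N = mat 1"
      by (auto simp: invertible_def)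
    have Nf: "N *v f x v = v" for v by (simp add: M[symmetric] matrix_vector_mul_assoc N)
    have fN: "f x (N *v v) = v" for v by (simp add: M[symmetric] matrix_vector_mul_assoc N)
    have inj: "inj (f x)" by (metis injI Nf)
    have img: "(\<lambda>i. f x (h i)) ` {..<card B} = f x ` B"
      using h by (metis bij_betw_imp_surj_on image_image)
    have "f x ` S x\<^sub>0 = S x"
    proof
      show "f x ` S x\<^sub>0 \<subseteq> S x" using fS by blast
      show "S x \<subseteq> f x ` S x\<^sub>0"
      proof
        fix w assume w: "w \<in> S x"
        define y where "y = N *v w"
        define a where "a = proj x\<^sub>0 y"
        have "f x (y - a) = w - f x a" by (simp add: fx.diff y_def fN)
        moreover have "w - f x a \<in> S x"
          using vec.subspace_diff[OF subspace_S w fS[OF proj_mem]] by (simp add: a_def)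
        moreover have "f x (y - a) \<in> U x" using fU diff_proj_mem by (simp add: a_def)
        ultimately have "w - f x a = 0" using trivial_intersection by metis
        thus "w \<in> f x ` S x\<^sub>0" using proj_mem[of x\<^sub>0 y] by (auto simp: a_def)
      qed
    qed
    moreover have "vec.independent (f x ` B)"
      using B(2) inj by (intro fx.independent_injective_image) (auto intro: inj_on_subset)
    moreover have "inj_on (\<lambda>i. f x (h i)) {..<card B}"
      using h inj by (auto simp: bij_betw_def inj_on_def)
    ultimately show ?thesis by (simp add: img fx.span_image spanB)
  qed
  have "continuous_on W (\<lambda>x. f x (h i))" for i
    using cont[of "h i"] by (auto simp: M intro: continuous_on_subset)
  with frame \<open>open W\<close> \<open>x\<^sub>0 \<in> W\<close>
  show "\<exists>W (k::nat) F. open W \<and> x\<^sub>0 \<in> W \<and> (\<forall>i<k. continuous_on W (F i)) \<and>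
      (\<forall>x\<in>W. inj_on (\<lambda>i. F i x) {..<k} \<and> vec.independent ((\<lambda>i. F i x) ` {..<k}) \<and>
        vec.span ((\<lambda>i. F i x) ` {..<k}) = S x)"
    by (intro exI[of _ W] exI[of _ "card B"] exI[of _ "\<lambda>i x. f x (h i)"]) auto
qed

end

lemma (in closed_splitting) swap: "closed_splitting U S (K + 1)"
proof
  show "\<exists>u\<in>U x. v - u \<in> S x" for x v
    using decomposition[of x v] by (metis diff_diff_eq2 add_diff_cancel_left')
  show "norm u \<le> (K + 1) * norm (u + s)" if "u \<in> U x" "s \<in> S x" for u s x
    using norm_S_le[OF that(2,1)] norm_triangle_ineq4[of "s + u" s]
    by (simp add: algebra_simps)
  show "v = 0" if "v \<in> U x" "v \<in> S x" for v x
    using that(2,1) by (rule trivial_intersection)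
qed (fact subspace_S subspace_U closed_S closed_U)+

section \<open>Decompositions by duality\<close>

definition cadjoint :: "complex ^ 'n ^ 'm \<Rightarrow> complex ^ 'm ^ 'n" where
  "cadjoint A = (\<chi> i j. cnj (A $ j $ i))"

text \<open>The inner product here is the real one, \<open>Re (\<Sum>i. x\<^sub>i * cnj y\<^sub>i)\<close>; the conjugate transpose is
  the adjoint for it as well.\<close>

lemma inner_matrix_vector_mult:
  fixes A :: "complex ^ 'n ^ 'm"
  shows "inner (A *v x) y = inner x (cadjoint A *v y)"
proof -
  have "inner (A *v x) y = (\<Sum>i\<in>UNIV. \<Sum>j\<in>UNIV. inner (A $ i $ j * x $ j) (y $ i))"
    by (simp add: inner_vec_def matrix_vector_mult_def inner_sum_left)
  also have "\<dots> = (\<Sum>j\<in>UNIV. \<Sum>i\<in>UNIV. inner (A $ i $ j * x $ j) (y $ i))"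
    by (rule sum.swap)
  also have "\<dots> = (\<Sum>j\<in>UNIV. \<Sum>i\<in>UNIV. inner (x $ j) (cnj (A $ i $ j) * y $ i))"
    by (intro sum.cong refl) (simp add: inner_complex_def algebra_simps)
  finally show ?thesis
    by (simp add: inner_vec_def matrix_vector_mult_def cadjoint_def inner_sum_right)
qed

text \<open>A lower bound for the adjoint of \<open>(p, q) \<mapsto> X p + Y q\<close> makes this map surjective, with control of
  a preimage: solve \<open>(X X\<^sup>* + Y Y\<^sup>*) r = v\<close> and take \<open>p = X\<^sup>* r\<close>, \<open>q = Y\<^sup>* r\<close>. Pairing the equation
  with \<open>r\<close> gives \<open>\<parallel>p\<parallel>\<^sup>2 + \<parallel>q\<parallel>\<^sup>2 = \<langle>v, r\<rangle>\<close>, and the lower bound limits \<open>\<parallel>r\<parallel>\<close> by \<open>max \<parallel>p\<parallel> \<parallel>q\<parallel> / c\<close>.\<close>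

lemma exists_decomposition_of_adjoint_lower_bound:
  fixes X Y :: "complex ^ 'n ^ 'n"
  assumes c: "c > 0" and low: "\<And>r. c * norm r \<le> max (norm (cadjoint X *v r)) (norm (cadjoint Y *v r))"
  obtains p q where "v = X *v p + Y *v q" "c * norm p \<le> norm v" "c * norm q \<le> norm v"
proof -
  define G where "G = X ** cadjoint X + Y ** cadjoint Y"
  have G: "G *v r = X *v (cadjoint X *v r) + Y *v (cadjoint Y *v r)" for r
    by (simp add: G_def matrix_vector_mult_add_rdistrib matrix_vector_mul_assoc)
  have inner_G: "inner (G *v r) r = (norm (cadjoint X *v r))\<^sup>2 + (norm (cadjoint Y *v r))\<^sup>2" for r
    by (simp add: G inner_add_left inner_matrix_vector_mult power2_norm_eq_inner)
  have "r = 0" if "G *v r = 0" for r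
  proof -
    have "norm (cadjoint X *v r) = 0" "norm (cadjoint Y *v r) = 0"
      using inner_G[of r] that by (simp_all add: sum_power2_eq_zero_iff)
    hence "c * norm r \<le> 0" using low[of r] by simp
    thus ?thesis using c by (simp add: mult_le_0_iff)
  qed
  then obtain H where "H ** G = mat 1" using matrix_left_invertible_ker by blast
  hence "G ** H = mat 1" using matrix_left_right_inverse by blast
  hence v: "G *v (H *v v) = v" by (simp add: matrix_vector_mul_assoc)
  define r where "r = H *v v"
  define p where "p = cadjoint X *v r"
  define q where "q = cadjoint Y *v r"
  define m where "m = max (norm p) (norm q)"
  have m: "0 \<le> m" "norm p \<le> m" "norm q \<le> m" by (auto simp: m_def le_max_iff_disj)
  have "m\<^sup>2 \<le> (norm p)\<^sup>2 + (norm q)\<^sup>2" by (simp add: m_def max_def)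
  also have "\<dots> = inner v r" using inner_G[of r] v by (simp add: r_def p_def q_def)
  also have "\<dots> \<le> norm v * norm r" by (rule norm_cauchy_schwarz)
  finally have "m * m \<le> norm v * norm r" by (simp add: power2_eq_square)
  moreover have "c * norm r \<le> m" using low[of r] by (simp add: m_def p_def q_def)
  ultimately have "c * (m * m) \<le> norm v * m"
    using c by (smt (verit) mult.left_commute mult_left_mono norm_ge_zero)
  hence "(c * m) * m \<le> norm v * m" by (simp add: mult.assoc)
  hence cm: "c * m \<le> norm v" using m(1) by (cases "m = 0") (auto simp: mult_le_cancel_right)
  have "v = X *v p + Y *v q" using v by (simp add: G p_def q_def r_def)
  moreover have "c * norm p \<le> norm v" "c * norm q \<le> norm v"
    using cm m c by (smt (verit) mult_left_mono)+
  ultimately show ?thesis using that by blast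
qed


section \<open>Linear flows and their stable spaces\<close>

definition stable_space :: "(int \<Rightarrow> 'w \<Rightarrow> complex ^ 'n ^ 'n) \<Rightarrow> 'w \<Rightarrow> (complex ^ 'n) set" where
  "stable_space \<Phi> x = {v. \<exists>B. \<forall>n::nat. norm (\<Phi> (int n) x *v v) \<le> B}"

lemma stable_spaceI: "(\<And>n::nat. norm (\<Phi> (int n) x *v v) \<le> B) \<Longrightarrow> v \<in> stable_space \<Phi> x"
  unfolding stable_space_def by blast

lemma subspace_stable_space: "vec.subspace (stable_space \<Phi> x)"
  unfolding vec.subspace_def
proof (intro conjI ballI allI)
  show "0 \<in> stable_space \<Phi> x" by (rule stable_spaceI[of _ _ _ 0]) simp
  fix v assume "v \<in> stable_space \<Phi> x"
  then obtain B where B: "\<And>n::nat. norm (\<Phi> (int n) x *v v) \<le> B"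
    by (auto simp: stable_space_def)
  show "v + w \<in> stable_space \<Phi> x" if "w \<in> stable_space \<Phi> x" for w
  proof -
    obtain B' where B': "\<And>n::nat. norm (\<Phi> (int n) x *v w) \<le> B'"
      using \<open>w \<in> _\<close> by (auto simp: stable_space_def)
    show ?thesis
      by (rule stable_spaceI[of _ _ _ "B + B'"])
        (metis B B' matrix_vector_right_distrib norm_triangle_mono)
  qed
  fix c
  have "norm (\<Phi> (int n) x *v (c *s v)) = norm c * norm (\<Phi> (int n) x *v v)" for n
    by (simp add: vec.scale norm_vec_def norm_mult L2_set_right_distrib)
  thus "c *s v \<in> stable_space \<Phi> x"
    by (intro stable_spaceI[of _ _ _ "norm c * B"]) (simp add: B mult_left_mono)
qed

text \<open>A cocycle is used only through its family of iterates, indexed by \<^typ>\<open>int\<close>. In this form time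
  reversal \<open>i \<mapsto> - i\<close> maps linear flows to linear flows, so that every statement about the past is
  an instance of one about the future; in particular the unstable space of \<open>\<Phi>\<close> is the stable space
  of the reversed flow.\<close>

locale linear_flow =
  fixes \<theta> :: "int \<Rightarrow> 'w::metric_space \<Rightarrow> 'w" and \<Phi> :: "int \<Rightarrow> 'w \<Rightarrow> complex ^ 'n ^ 'n"
  assumes flow_0: "\<Phi> 0 x = mat 1"
    and flow_add: "\<Phi> (i + j) x = \<Phi> i (\<theta> j x) ** \<Phi> j x"
    and base_add: "\<theta> (i + j) x = \<theta> i (\<theta> j x)"
    and continuous_flow: "continuous_on UNIV (\<Phi> i)"
    and compact_base: "compact (UNIV :: 'w set)"
begin

lemma reverse: "linear_flow (\<lambda>i. \<theta> (- i)) (\<lambda>i. \<Phi> (- i))"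
proof
  show "\<Phi> (- (i + j)) x = \<Phi> (- i) (\<theta> (- j) x) ** \<Phi> (- j) x" for i j x
    using flow_add[of "- i" "- j" x] by simp
  show "\<theta> (- (i + j)) x = \<theta> (- i) (\<theta> (- j) x)" for i j x
    using base_add[of "- i" "- j" x] by simp
qed (simp_all add: flow_0 continuous_flow compact_base)

lemma flow_add_vec: "\<Phi> (i + j) x *v v = \<Phi> i (\<theta> j x) *v (\<Phi> j x *v v)"
  by (simp add: flow_add matrix_vector_mul_assoc)

lemma flow_minus_cancel: "\<Phi> (- i) (\<theta> i x) *v (\<Phi> i x *v v) = v"
  using flow_add_vec[of "- i" i x v] by (simp add: flow_0)

lemma flow_inverse: "\<Phi> i x ** \<Phi> (- i) (\<theta> i x) = mat 1"
proof -
  have "\<Phi> (- i) (\<theta> i x) ** \<Phi> i x = mat 1" using flow_add[of "- i" i x] by (simp add: flow_0)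
  thus ?thesis using matrix_left_right_inverse by blast
qed

lemma bounded_flow: obtains M where "M \<ge> 0" "\<And>x v. norm (\<Phi> i x *v v) \<le> M * norm v"
proof -
  have cont: "continuous_on (UNIV \<times> sphere 0 1) (\<lambda>p. \<Phi> i (fst p) *v snd p)"
  proof -
    have "continuous_on (UNIV \<times> sphere 0 1) (\<lambda>p. \<Phi> i (fst p))"
      by (rule continuous_on_compose2[OF continuous_flow]) (auto intro: continuous_intros)
    moreover have "continuous_on (UNIV \<times> sphere 0 1) (snd :: 'w \<times> (complex ^ 'n) \<Rightarrow> _)"
      by (rule continuous_on_snd) (rule continuous_on_id)
    ultimately show ?thesis
      unfolding continuous_on_def by (auto intro!: tendsto_matrix_vector_mult)
  qed
  have "compact (UNIV \<times> sphere 0 1 :: ('w \<times> (complex ^ 'n)) set)"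
    by (intro compact_Times compact_base compact_sphere)
  from compact_imp_bounded[OF compact_continuous_image[OF cont this]]
  obtain M where M: "\<And>x v. v \<in> sphere 0 1 \<Longrightarrow> norm (\<Phi> i x *v v) \<le> M"
    unfolding bounded_iff by force
  have "norm (\<Phi> i x *v v) \<le> max M 0 * norm v" for x v
  proof (cases "v = 0")
    case False
    define u where "u = v /\<^sub>R norm v"
    have v: "v = norm v *\<^sub>R u" using False by (simp add: u_def)
    have "norm (\<Phi> i x *v u) \<le> M" using False by (intro M) (simp add: u_def)
    moreover have "norm (\<Phi> i x *v v) = norm v * norm (\<Phi> i x *v u)"
      by (subst v) (simp add: linear_scale bounded_linear.linear[OF matrix_vector_mul_bounded_linear])
    ultimately show ?thesis
      by (smt (verit) mult.commute mult_right_mono norm_ge_zero)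
  qed simp
  thus ?thesis using that[of "max M 0"] by simp
qed

text \<open>Passing to another time changes the forward orbit by finitely many vectors only, whence the
  maximum over the first \<open>\<bar>i\<bar>\<close> of them in the bound.\<close>

lemma stable_space_invariant:
  assumes "v \<in> stable_space \<Phi> x"
  shows "\<Phi> i x *v v \<in> stable_space \<Phi> (\<theta> i x)"
proof -
  obtain B where B: "\<And>n::nat. norm (\<Phi> (int n) x *v v) \<le> B"
    using assms by (auto simp: stable_space_def)
  define m where "m = nat \<bar>i\<bar>"
  define B' where "B' = max B (Max ((\<lambda>n. norm (\<Phi> (int n + i) x *v v)) ` {..m}))"
  show ?thesis
  proof (rule stable_spaceI)
    fix n :: nat
    have "norm (\<Phi> (int n + i) x *v v) \<le> B'"
    proof (cases "n \<le> m")
      case True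
      thus ?thesis unfolding B'_def by (intro max.coboundedI2 Max_ge) auto
    next
      case False
      hence "int n + i = int (nat (int n + i))" by (simp add: m_def)
      thus ?thesis using B[of "nat (int n + i)"] by (simp add: B'_def le_max_iff_disj)
    qed
    thus "norm (\<Phi> (int n) (\<theta> i x) *v (\<Phi> i x *v v)) \<le> B'" by (simp add: flow_add_vec)
  qed
qed

end

text \<open>If \<open>L\<close> at least doubles \<open>u\<close> and, up to \<open>e\<close>, halves \<open>s\<close>, then \<open>u\<close> and \<open>s\<close> cannot nearly cancel:
  \<open>L (s + u)\<close> would be too large in comparison with \<open>s + u\<close>.\<close>

lemma norm_le_of_doubling_and_halving:
  fixes L :: "'a::real_normed_vector \<Rightarrow> 'b::real_normed_vector"
  assumes "linear L" and bound: "norm (L (s + u)) \<le> M * norm (s + u)"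
    and double: "2 * norm u \<le> norm (L u)" and halve: "norm (L s) \<le> norm s / 2 + e"
    and "0 \<le> e"
  shows "norm u \<le> (M + 1) * norm (s + u) + e"
proof -
  have "L u = L (s + u) - L s" using assms(1) by (simp add: linear_add)
  hence "norm (L u) \<le> norm (L (s + u)) + norm (L s)" by (metis norm_triangle_ineq4)
  moreover have "norm s \<le> norm (s + u) + norm u"
    using norm_triangle_ineq4[of "s + u" u] by simp
  ultimately have "3 * norm u \<le> 2 * (M * norm (s + u)) + norm (s + u) + 2 * e"
    using bound double halve by linarith
  moreover have "0 \<le> M * norm (s + u)" using bound norm_ge_zero order_trans by blast
  moreover have "(M + 1) * norm (s + u) = M * norm (s + u) + norm (s + u)"
    by (simp add: algebra_simps)
  ultimately show ?thesis using \<open>0 \<le> e\<close> norm_ge_zero[of "s + u"] by linarith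
qed

lemma linear_matrix: "linear ((*v) (A :: complex ^ 'n ^ 'm))"
  by (rule bounded_linear.linear) simp

text \<open>Expansion on \<open>U\<close> and contraction on \<open>S\<close> bound the projections uniformly: a fixed time \<open>k\<close> with
  \<open>lam ^ k \<ge> 2 C\<close> doubles \<open>U\<close> and halves \<open>S\<close>, and the flow at this time is bounded by compactness of
  the base.\<close>

lemma (in linear_flow) splitting_bound:
  assumes C: "C > 0" and lam: "lam > 1"
    and expand: "\<And>x u n. u \<in> U x \<Longrightarrow> lam ^ n * norm u \<le> C * norm (\<Phi> (int n) x *v u)"
    and contract: "\<And>x s n. s \<in> S x \<Longrightarrow> lam ^ n * norm (\<Phi> (int n) x *v s) \<le> C * norm s"
  obtains K where "K > 0" "\<And>x s u. s \<in> S x \<Longrightarrow> u \<in> U x \<Longrightarrow> norm s \<le> K * norm (s + u)"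
    "\<And>x s u. s \<in> S x \<Longrightarrow> u \<in> U x \<Longrightarrow> norm u \<le> K * norm (s + u)"
proof -
  obtain k where k: "2 * C \<le> lam ^ k" using real_arch_pow[OF lam] less_imp_le by blast
  obtain M where M: "M \<ge> 0" "\<And>x v. norm (\<Phi> (int k) x *v v) \<le> M * norm v"
    using bounded_flow[of "int k"] by blast
  have u: "norm u \<le> (M + 1) * norm (s + u)" if s: "s \<in> S x" and u: "u \<in> U x" for x s u
  proof -
    have "2 * C * norm u \<le> C * norm (\<Phi> (int k) x *v u)"
      using expand[OF u, of k] mult_right_mono[OF k norm_ge_zero, of u] by linarith
    hence "2 * norm u \<le> norm (\<Phi> (int k) x *v u)" using C by (simp add: mult.assoc mult.left_commute)
    moreover have "2 * C * norm (\<Phi> (int k) x *v s) \<le> C * norm s"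
      using contract[OF s, of k] mult_right_mono[OF k norm_ge_zero, of "\<Phi> (int k) x *v s"]
      by linarith
    hence "norm (\<Phi> (int k) x *v s) \<le> norm s / 2"
      using C by (simp add: mult.assoc mult.left_commute)
    ultimately show ?thesis
      using norm_le_of_doubling_and_halving[OF linear_matrix M(2), where u = u and s = s and e = 0]
      by simp
  qed
  have s: "norm s \<le> (M + 2) * norm (s + u)" if "s \<in> S x" "u \<in> U x" for x s u
  proof -
    have "norm s \<le> norm (s + u) + norm u" using norm_triangle_ineq4[of "s + u" u] by simp
    thus ?thesis using u[OF that] by (simp add: distrib_right)
  qed
  show ?thesis
  proof (rule that[of "M + 2"])
    show "norm u \<le> (M + 2) * norm (s + u)" if "s \<in> S x" "u \<in> U x" for x s u
    proof -
      have "(M + 1) * norm (s + u) \<le> (M + 2) * norm (s + u)" by (intro mult_right_mono) auto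
      thus ?thesis using u[OF that] by linarith
    qed
  qed (use M(1) s in auto)
qed

text \<open>The larger of the two components of \<open>v\<close> has at least half the norm of \<open>v\<close>. It grows, in the
  future if it lies in \<open>U\<close> and in the past if it lies in \<open>S\<close>, and since the projections are bounded the
  whole orbit grows with it.\<close>

lemma (in linear_flow) growth_of_splitting:
  assumes C: "C > 0" and lam: "lam > 1"
    and sum: "\<And>x v. \<exists>s\<in>S x. \<exists>u\<in>U x. v = s + u"
    and expand: "\<And>x u n. u \<in> U x \<Longrightarrow> lam ^ n * norm u \<le> C * norm (\<Phi> (int n) x *v u)"
    and contract: "\<And>x s n. s \<in> S x \<Longrightarrow> lam ^ n * norm s \<le> C * norm (\<Phi> (- int n) x *v s)"
    and inv_S: "\<And>x i v. v \<in> S x \<Longrightarrow> \<Phi> i x *v v \<in> S (\<theta> i x)"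
    and inv_U: "\<And>x i v. v \<in> U x \<Longrightarrow> \<Phi> i x *v v \<in> U (\<theta> i x)"
  shows "\<exists>b>0. \<forall>x v. (\<forall>n. b * lam ^ n * norm v \<le> norm (\<Phi> (int n) x *v v)) \<or>
    (\<forall>n. b * lam ^ n * norm v \<le> norm (\<Phi> (- int n) x *v v))"
proof -
  have forward: "lam ^ n * norm (\<Phi> (int n) x *v s) \<le> C * norm s" if "s \<in> S x" for x s n
    using contract[OF inv_S[OF that, of "int n"], of n] by (simp add: flow_minus_cancel)
  obtain K where K: "K > 0"
      "\<And>x s u. s \<in> S x \<Longrightarrow> u \<in> U x \<Longrightarrow> norm s \<le> K * norm (s + u)"
      "\<And>x s u. s \<in> S x \<Longrightarrow> u \<in> U x \<Longrightarrow> norm u \<le> K * norm (s + u)"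
    using splitting_bound[where S = S and U = U, OF C lam expand forward] by blast
  \<comment> \<open>The losses: \<open>2\<close> for the larger component, \<open>K\<close> for the projection, \<open>C\<close> for the expansion.\<close>
  define b where "b = 1 / (2 * K * C)"
  have b: "b > 0" "2 * K * C * b = 1" using K(1) C by (auto simp: b_def)
  have key: "b * lam ^ n * norm v \<le> d"
    if "norm v \<le> 2 * norm w" "lam ^ n * norm w \<le> C * e" "e \<le> K * d" for n d e and v w :: "complex ^ 'n"
  proof -
    have "lam ^ n * norm v \<le> lam ^ n * (2 * norm w)"
      using lam that(1) by (intro mult_left_mono) auto
    also have "\<dots> \<le> 2 * (C * (K * d))"
    proof -
      have "C * e \<le> C * (K * d)" using that(3) C by (intro mult_left_mono) auto
      thus ?thesis using that(2) by linarith
    qed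
    finally have "b * (lam ^ n * norm v) \<le> b * (2 * (C * (K * d)))"
      using b(1) by (intro mult_left_mono) auto
    also have "\<dots> = (2 * K * C * b) * d" by (simp only: mult_ac)
    also have "\<dots> = d" by (simp only: b(2) mult_1)
    finally show ?thesis by (simp only: mult.assoc)
  qed
  have "(\<forall>n. b * lam ^ n * norm v \<le> norm (\<Phi> (int n) x *v v)) \<or>
    (\<forall>n. b * lam ^ n * norm v \<le> norm (\<Phi> (- int n) x *v v))" for x v
  proof -
    obtain s u where su: "s \<in> S x" "u \<in> U x" and v: "v = s + u" using sum by metis
    have split: "\<Phi> i x *v v = \<Phi> i x *v s + \<Phi> i x *v u" for i
      by (simp add: v matrix_vector_right_distrib)
    consider "norm v \<le> 2 * norm u" | "norm v \<le> 2 * norm s"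
      using norm_triangle_ineq[of s u] v by fastforce
    thus ?thesis
    proof cases
      case 1
      have "b * lam ^ n * norm v \<le> norm (\<Phi> (int n) x *v v)" for n
        using key[OF 1 expand[OF su(2)] K(3)[OF inv_S[OF su(1)] inv_U[OF su(2)]]]
        by (simp add: split)
      thus ?thesis by blast
    next
      case 2
      have "b * lam ^ n * norm v \<le> norm (\<Phi> (- int n) x *v v)" for n
        using key[OF 2 contract[OF su(1)] K(2)[OF inv_S[OF su(1)] inv_U[OF su(2)]]]
        by (simp add: split)
      thus ?thesis by blast
    qed
  qed
  thus ?thesis using b(1) by blast
qed

section \<open>Uniformly growing flows\<close>

text \<open>Shrinking the constant \<open>b\<close> below \<open>1\<close> makes the growth inequalities hold at time \<open>0\<close> too, which
  removes case distinctions at the ends of orbit segments.\<close>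

locale growing_flow = linear_flow +
  fixes b lam :: real
  assumes b: "0 < b" "b \<le> 1" and lam: "1 < lam"
    and growth: "(\<forall>n. b * lam ^ n * norm v \<le> norm (\<Phi> (int n) x *v v)) \<or>
      (\<forall>n. b * lam ^ n * norm v \<le> norm (\<Phi> (- int n) x *v v))"
begin

lemma reverse_growing: "growing_flow (\<lambda>i. \<theta> (- i)) (\<lambda>i. \<Phi> (- i)) b lam"
proof -
  interpret r: linear_flow "\<lambda>i. \<theta> (- i)" "\<lambda>i. \<Phi> (- i)" by (rule reverse)
  show ?thesis by unfold_locales (use b lam growth in auto)
qed

text \<open>Growth applied to the vector at time \<open>k\<close>: it is dominated by one of the two ends of the segment.\<close>

lemma orbit_segment_growth:
  assumes "k \<le> N"
  shows "b * lam ^ (N - k) * norm (\<Phi> (int k) x *v v) \<le> norm (\<Phi> (int N) x *v v) \<or>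
    b * lam ^ k * norm (\<Phi> (int k) x *v v) \<le> norm v"
proof -
  have "\<Phi> (int (N - k)) (\<theta> (int k) x) *v (\<Phi> (int k) x *v v) = \<Phi> (int N) x *v v"
    using flow_add_vec[of "int (N - k)" "int k" x v] assms by simp
  moreover have "\<Phi> (- int k) (\<theta> (int k) x) *v (\<Phi> (int k) x *v v) = v"
    by (rule flow_minus_cancel)
  ultimately show ?thesis
    using growth[of "\<Phi> (int k) x *v v" "\<theta> (int k) x"]
    by (auto dest: spec[of _ "N - k"] spec[of _ k])
qed

lemma orbit_segment_bound:
  assumes "k \<le> N"
  shows "b * norm (\<Phi> (int k) x *v v) \<le> max (norm v) (norm (\<Phi> (int N) x *v v))"
proof -
  have "b * norm (\<Phi> (int k) x *v v) \<le> b * lam ^ j * norm (\<Phi> (int k) x *v v)" for j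
    using b lam one_le_power[of lam j] by (intro mult_right_mono) auto
  thus ?thesis using orbit_segment_growth[OF assms, of x v] by (meson le_max_iff_disj order_trans)
qed

text \<open>A nonzero vector with bounded forward orbit cannot grow forward, so all of its forward iterates
  grow backward; read at time \<open>0\<close>, this is exponential decay. In particular forward boundedness is
  equivalent to a bound with constants depending on \<open>b\<close> and \<open>lam\<close> only, which survives limits in
  \<open>stable_space_closed\<close>.\<close>

lemma stable_space_decay:
  assumes "v \<in> stable_space \<Phi> x"
  shows "b * lam ^ n * norm (\<Phi> (int n) x *v v) \<le> norm v"
proof -
  define w where "w = \<Phi> (int n) x *v v"
  have w: "w \<in> stable_space \<Phi> (\<theta> (int n) x)"
    unfolding w_def by (rule stable_space_invariant[OF assms])
  then obtain B where B: "\<And>m::nat. norm (\<Phi> (int m) (\<theta> (int n) x) *v w) \<le> B"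
    by (auto simp: stable_space_def)
  have vw: "\<Phi> (- int n) (\<theta> (int n) x) *v w = v" by (simp add: w_def flow_minus_cancel)
  show ?thesis
  proof (cases "w = 0")
    case False
    obtain m where "B / (b * norm w) < lam ^ m" using real_arch_pow[OF lam] by blast
    hence "B < b * lam ^ m * norm w" using b False by (simp add: field_simps)
    hence "\<not> b * lam ^ m * norm w \<le> norm (\<Phi> (int m) (\<theta> (int n) x) *v w)"
      using B[of m] by linarith
    hence "b * lam ^ n * norm w \<le> norm (\<Phi> (- int n) (\<theta> (int n) x) *v w)"
      using growth[of w "\<theta> (int n) x"] by blast
    thus ?thesis unfolding vw by (simp add: w_def)
  qed (simp add: w_def)
qed

lemma stable_space_closed:
  assumes "f \<longlonglongrightarrow> x" "g \<longlonglongrightarrow> v" "\<And>n. g n \<in> stable_space \<Phi> (f n)"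
  shows "v \<in> stable_space \<Phi> x"
proof (rule stable_spaceI)
  fix k :: nat
  have "b * norm (\<Phi> (int k) (f n) *v g n) \<le> norm (g n)" for n
  proof -
    have "b * norm (\<Phi> (int k) (f n) *v g n) \<le> b * lam ^ k * norm (\<Phi> (int k) (f n) *v g n)"
      using b lam by (intro mult_right_mono) auto
    thus ?thesis using stable_space_decay[OF assms(3), of k n] by linarith
  qed
  moreover have "(\<lambda>n. b * norm (\<Phi> (int k) (f n) *v g n)) \<longlonglongrightarrow> b * norm (\<Phi> (int k) x *v v)"
  proof -
    have "(\<lambda>n. \<Phi> (int k) (f n)) \<longlonglongrightarrow> \<Phi> (int k) x"
      by (rule continuous_on_tendsto_compose[OF continuous_flow assms(1)]) auto
    thus ?thesis
      by (intro tendsto_mult_left tendsto_norm tendsto_matrix_vector_mult assms(2))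
  qed
  ultimately have "b * norm (\<Phi> (int k) x *v v) \<le> norm v"
    using tendsto_norm[OF assms(2)] by (intro LIMSEQ_le) auto
  thus "norm (\<Phi> (int k) x *v v) \<le> norm v / b" using b by (simp add: field_simps)
qed

abbreviation stable where "stable \<equiv> stable_space \<Phi>"
abbreviation unstable where "unstable \<equiv> stable_space (\<lambda>i. \<Phi> (- i))"

lemma unstable_invariant: "v \<in> unstable x \<Longrightarrow> \<Phi> i x *v v \<in> unstable (\<theta> i x)"
  using linear_flow.stable_space_invariant[OF reverse, of v x "- i"] by simp

text \<open>This is the decay of the reversed flow at the point \<open>\<theta> n x\<close>.\<close>

lemma unstable_expansion:
  assumes "u \<in> unstable x"
  shows "b * lam ^ n * norm u \<le> norm (\<Phi> (int n) x *v u)"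
  using growing_flow.stable_space_decay[OF reverse_growing unstable_invariant[OF assms, of "int n"], of n]
  by (simp add: flow_minus_cancel)

lemma unstable_decay:
  "u \<in> unstable x \<Longrightarrow> b * lam ^ n * norm (\<Phi> (- int n) x *v u) \<le> norm u"
  by (rule growing_flow.stable_space_decay[OF reverse_growing])

lemma trivial_intersection:
  assumes "v \<in> stable x" "v \<in> unstable x"
  shows "v = 0"
proof (rule ccontr)
  assume "v \<noteq> 0"
  have *: "b * lam ^ n * (b * lam ^ n * norm v) \<le> norm v" for n
  proof -
    have "b * lam ^ n * (b * lam ^ n * norm v) \<le> b * lam ^ n * norm (\<Phi> (int n) x *v v)"
      using unstable_expansion[OF assms(2)] b lam by (intro mult_left_mono) auto
    thus ?thesis using stable_space_decay[OF assms(1), of n] by linarith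
  qed
  obtain n where "1 / b < lam ^ n" using real_arch_pow[OF lam] by blast
  hence n: "1 < b * lam ^ n" using b by (simp add: field_simps)
  hence "1 < (b * lam ^ n) * (b * lam ^ n)" by (rule less_1_mult) fact
  hence "norm v < (b * lam ^ n) * (b * lam ^ n) * norm v" using \<open>v \<noteq> 0\<close> by simp
  thus False using *[of n] by (simp add: mult.assoc)
qed

end

section \<open>The stable and unstable spaces span\<close>

text \<open>The matrix \<open>\<Phi> (- n) (\<theta> n x)\<close> is the inverse of \<open>\<Phi> n x\<close>, so its adjoint is the time \<open>n\<close> map of the
  dual flow, and similarly for \<open>\<Phi> n (\<theta> (- n) x)\<close> and time \<open>- n\<close>. The assumption is thus a weak form of
  growth for the dual flow. Without it the dimensions of the stable and of the unstable spaces may add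
  up to less than the dimension of the whole space at some points of the base.\<close>

locale balanced_growing_flow = growing_flow +
  assumes dual_growth: "b * norm r \<le> max (norm (cadjoint (\<Phi> (- int n) (\<theta> (int n) x)) *v r))
      (norm (cadjoint (\<Phi> (int n) (\<theta> (- int n) x)) *v r))"
begin

text \<open>With \<open>X = (\<Phi> N x)\<inverse>\<close> and \<open>Y = (\<Phi> (- N) x)\<inverse>\<close>, a decomposition \<open>v = X p + Y q\<close> has \<open>\<Phi> N x (X p) = p\<close> and
  \<open>\<Phi> (- N) x (Y q) = q\<close>, and duality makes \<open>p\<close> and \<open>q\<close> bounded.\<close>

lemma finite_time_decomposition:
  obtains s u where "v = s + u" "b * norm (\<Phi> (int N) x *v s) \<le> norm v"
    "b * norm (\<Phi> (- int N) x *v u) \<le> norm v"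
proof -
  obtain p q where pq: "v = \<Phi> (- int N) (\<theta> (int N) x) *v p + \<Phi> (int N) (\<theta> (- int N) x) *v q"
      "b * norm p \<le> norm v" "b * norm q \<le> norm v"
    using exists_decomposition_of_adjoint_lower_bound[OF b(1) dual_growth] by blast
  have cancel: "\<Phi> i x *v (\<Phi> (- i) (\<theta> i x) *v w) = w" for i w
    by (simp add: matrix_vector_mul_assoc flow_inverse)
  show ?thesis
    using that[OF pq(1)] pq(2,3) cancel[of "int N" p] cancel[of "- int N" q] by simp
qed

text \<open>The bounds at the times \<open>\<plusminus> N\<close> do not yet exclude that \<open>s\<close> and \<open>u\<close> are huge and nearly opposite. If \<open>u\<close>
  grows backward, then the bound at time \<open>- N\<close> controls \<open>u\<close> itself. If \<open>u\<close> grows forward, then it is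
  doubled at a fixed time \<open>k\<close>, while \<open>s\<close>, being dominated at time \<open>k\<close> by one of the ends of the segment
  from \<open>0\<close> to \<open>N\<close>, is halved or already bounded; so again \<open>u\<close> is controlled. Once the ends of an orbit
  segment are bounded, so is the whole segment.\<close>

lemma uniform_finite_time_decomposition:
  obtains B N\<^sub>0 where "\<And>x v N. N \<ge> N\<^sub>0 \<Longrightarrow> \<exists>s. norm s \<le> B * norm v \<and>
    (\<forall>k\<le>N. norm (\<Phi> (int k) x *v s) \<le> B * norm v \<and> norm (\<Phi> (- int k) x *v (v - s)) \<le> B * norm v)"
proof -
  obtain k where k: "2 / b \<le> lam ^ k" using real_arch_pow[OF lam] less_imp_le by blast
  hence k2: "2 \<le> b * lam ^ k" using b by (simp add: field_simps)
  obtain M where M: "M \<ge> 0" "\<And>x v. norm (\<Phi> (int k) x *v v) \<le> M * norm v"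
    using bounded_flow[of "int k"] by blast
  \<comment> \<open>One factor \<open>1 / b\<close> comes from the decomposition at time \<open>N\<close>, the other from the growth estimate.\<close>
  define e where "e = 1 / (b * b)"
  have e: "e \<ge> 1" "1 / b \<le> e" using b by (simp_all add: e_def field_simps mult_le_one)
  have le_e: "y \<le> e * z" if "b * y \<le> w" "b * w \<le> z" for y z w
  proof -
    have "b * (b * y) \<le> z" using that b mult_left_mono[OF that(1), of b] by linarith
    thus ?thesis using b by (simp add: e_def field_simps)
  qed
  define B where "B = (M + 2 + e) / b"
  show ?thesis
  proof (rule that[of k B])
    fix x v N assume N: "k \<le> N"
    obtain s u where v: "v = s + u" and s: "b * norm (\<Phi> (int N) x *v s) \<le> norm v"
      and u: "b * norm (\<Phi> (- int N) x *v u) \<le> norm v"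
      by (rule finite_time_decomposition)
    have weaken: "b * norm w \<le> b * lam ^ j * norm w" for w :: "complex ^ 'b" and j
      using b lam by (intro mult_right_mono) auto
    have nu: "norm u \<le> (M + 1 + e) * norm v"
    proof (cases "\<forall>n. b * lam ^ n * norm u \<le> norm (\<Phi> (int n) x *v u)")
      case True
      have "2 * norm u \<le> b * lam ^ k * norm u" using k2 by (intro mult_right_mono) auto
      hence double: "2 * norm u \<le> norm (\<Phi> (int k) x *v u)" using True order_trans by blast
      have halve: "norm (\<Phi> (int k) x *v s) \<le> norm s / 2 + e * norm v"
        using orbit_segment_growth[OF N, of x s]
      proof
        assume "b * lam ^ k * norm (\<Phi> (int k) x *v s) \<le> norm s"
        moreover have "2 * norm (\<Phi> (int k) x *v s) \<le> b * lam ^ k * norm (\<Phi> (int k) x *v s)"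
          using k2 by (intro mult_right_mono) auto
        moreover have "0 \<le> e * norm v" using e by simp
        ultimately show ?thesis by linarith
      next
        assume "b * lam ^ (N - k) * norm (\<Phi> (int k) x *v s) \<le> norm (\<Phi> (int N) x *v s)"
        hence "norm (\<Phi> (int k) x *v s) \<le> e * norm v"
          using le_e s weaken order_trans by blast
        thus ?thesis using norm_ge_zero[of s] by linarith
      qed
      show ?thesis
        using norm_le_of_doubling_and_halving[OF linear_matrix M(2) double halve] e v
        by (simp add: algebra_simps)
    next
      case False
      hence "b * norm u \<le> norm (\<Phi> (- int N) x *v u)"
        using growth[of u x] weaken order_trans by blast
      hence "norm u \<le> e * norm v" using u le_e by blast
      moreover have "0 \<le> (M + 1) * norm v" using M(1) by simp
      ultimately show ?thesis by (simp add: algebra_simps)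
    qed
    have ns: "norm s \<le> (M + 2 + e) * norm v"
    proof -
      have "norm s \<le> norm v + norm u" using norm_triangle_ineq4[of v u] v by simp
      thus ?thesis using nu by (simp add: distrib_right)
    qed
    have nu': "norm u \<le> (M + 2 + e) * norm v"
    proof -
      have "(M + 1 + e) * norm v \<le> (M + 2 + e) * norm v" by (intro mult_right_mono) auto
      thus ?thesis using nu by linarith
    qed
    have inv_b: "y \<le> B * norm v" if "b * y \<le> (M + 2 + e) * norm v" for y
      using that b by (simp add: B_def field_simps)
    have sum_ge: "norm v / b \<le> (M + 2 + e) * norm v"
    proof -
      have "1 / b * norm v \<le> (M + 2 + e) * norm v" using e M by (intro mult_right_mono) auto
      thus ?thesis by simp
    qed
    have ends: "norm (\<Phi> (int N) x *v s) \<le> (M + 2 + e) * norm v"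
      "norm (\<Phi> (- int N) x *v u) \<le> (M + 2 + e) * norm v"
      using s u b sum_ge by (simp_all add: pos_le_divide_eq[OF b(1)] mult.commute order_trans[of _ "norm v / b"])
    have "b * norm s \<le> norm s" using b by (simp add: mult_left_le_one_le)
    hence "norm s \<le> B * norm v" using ns by (intro inv_b) linarith
    moreover have "norm (\<Phi> (int j) x *v s) \<le> B * norm v" if "j \<le> N" for j
      using orbit_segment_bound[OF that, of x s] ns ends by (intro inv_b) linarith
    moreover have "norm (\<Phi> (- int j) x *v u) \<le> B * norm v" if "j \<le> N" for j
      using growing_flow.orbit_segment_bound[OF reverse_growing that, of x u] nu' ends
      by (intro inv_b) linarith
    ultimately show "\<exists>s. norm s \<le> B * norm v \<and> (\<forall>k\<le>N. norm (\<Phi> (int k) x *v s) \<le> B * norm v \<and>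
        norm (\<Phi> (- int k) x *v (v - s)) \<le> B * norm v)"
      using v by (intro exI[of _ s]) simp
  qed
qed

text \<open>A limit point of the uniformly bounded finite-time decompositions as \<open>N \<rightarrow> \<infinity>\<close> keeps every bound at
  a fixed time.\<close>

lemma decomposition: "\<exists>s\<in>stable x. v - s \<in> unstable x"
proof -
  obtain B N\<^sub>0 where "\<And>N. N \<ge> N\<^sub>0 \<Longrightarrow> \<exists>s. norm s \<le> B * norm v \<and>
    (\<forall>k\<le>N. norm (\<Phi> (int k) x *v s) \<le> B * norm v \<and> norm (\<Phi> (- int k) x *v (v - s)) \<le> B * norm v)"
    by (rule uniform_finite_time_decomposition) blast
  hence "\<forall>N. \<exists>s. norm s \<le> B * norm v \<and> (\<forall>k\<le>N + N\<^sub>0. norm (\<Phi> (int k) x *v s) \<le> B * norm v \<and>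
      norm (\<Phi> (- int k) x *v (v - s)) \<le> B * norm v)" by simp
  then obtain f where f: "\<And>N. norm (f N) \<le> B * norm v"
      "\<And>N k. k \<le> N + N\<^sub>0 \<Longrightarrow> norm (\<Phi> (int k) x *v f N) \<le> B * norm v"
      "\<And>N k. k \<le> N + N\<^sub>0 \<Longrightarrow> norm (\<Phi> (- int k) x *v (v - f N)) \<le> B * norm v"
    by metis
  have "bounded (range f)" using f(1) by (auto simp: bounded_iff)
  then obtain s r where r: "strict_mono (r :: nat \<Rightarrow> nat)" "(f \<circ> r) \<longlonglongrightarrow> s"
    using bounded_imp_convergent_subsequence by blast
  have late: "\<forall>\<^sub>F n in sequentially. k \<le> r n + N\<^sub>0" for k
    using eventually_ge_at_top[of k] by eventually_elim (meson r(1) seq_suble le_trans trans_le_add1)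
  have "s \<in> stable x"
  proof (rule stable_spaceI)
    fix k
    show "norm (\<Phi> (int k) x *v s) \<le> B * norm v"
      using late[of k] by (intro tendsto_upperbound[OF tendsto_norm[OF
            tendsto_matrix_vector_mult[OF tendsto_const r(2)]]]) (auto elim!: eventually_mono intro: f(2))
  qed
  moreover have "v - s \<in> unstable x"
  proof (rule stable_spaceI)
    fix k
    show "norm (\<Phi> (- int k) x *v (v - s)) \<le> B * norm v"
      using late[of k] by (intro tendsto_upperbound[OF tendsto_norm[OF
            tendsto_matrix_vector_mult[OF tendsto_const tendsto_diff[OF tendsto_const r(2)]]]])
          (auto elim!: eventually_mono intro: f(3))
  qed
  ultimately show ?thesis by blast
qed

lemma closed_splitting: "\<exists>K. closed_splitting stable unstable K"
proof -
  have expand: "lam ^ n * norm u \<le> 1 / b * norm (\<Phi> (int n) x *v u)" if "u \<in> unstable x" for x u n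
    using unstable_expansion[OF that, of n] b by (simp add: field_simps)
  have contract: "lam ^ n * norm (\<Phi> (int n) x *v s) \<le> 1 / b * norm s" if "s \<in> stable x" for x s n
    using stable_space_decay[OF that, of n] b by (simp add: field_simps)
  obtain K where K: "\<And>x s u. s \<in> stable x \<Longrightarrow> u \<in> unstable x \<Longrightarrow> norm s \<le> K * norm (s + u)"
  proof (rule splitting_bound[where S = stable and U = unstable and C = "1 / b" and lam = lam])
    show "0 < 1 / b" using b by simp
    fix K assume "\<And>x s u. s \<in> stable x \<Longrightarrow> u \<in> unstable x \<Longrightarrow> norm s \<le> K * norm (s + u)"
    thus thesis by (rule that)
  qed (rule lam, erule expand, erule contract)
  have "closed_splitting stable unstable K"
  proof
    show "vec.subspace (stable x)" "vec.subspace (unstable x)" for x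
      by (rule subspace_stable_space)+
    show "\<exists>s\<in>stable x. v - s \<in> unstable x" for x v by (rule decomposition)
    show "norm s \<le> K * norm (s + u)" if "s \<in> stable x" "u \<in> unstable x" for s u x
      using that by (rule K)
    show "v = 0" if "v \<in> stable x" "v \<in> unstable x" for v x
      using that by (rule trivial_intersection)
    show "v \<in> stable x" if "f \<longlonglongrightarrow> x" "g \<longlonglongrightarrow> v" "\<And>n. g n \<in> stable (f n)" for f x g v
      using that by (rule stable_space_closed)
    show "v \<in> unstable x" if "f \<longlonglongrightarrow> x" "g \<longlonglongrightarrow> v" "\<And>n. g n \<in> unstable (f n)" for f x g v
      using that by (rule growing_flow.stable_space_closed[OF reverse_growing])
  qed
  thus ?thesis by blast
qed

end


section \<open>The iterates form a linear flow\<close>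

lemma int_iterate_0: "int_iterate T 0 x = x"
  by (simp add: int_iterate_def)

lemma int_iterate_plus_1:
  assumes "bij T"
  shows "int_iterate T (i + 1) x = T (int_iterate T i x)"
proof (cases "i \<ge> 0")
  case True
  thus ?thesis by (simp add: int_iterate_def nat_add_distrib)
next
  case False
  then obtain m where i: "i = - int (Suc m)"
    by (metis add.inverse_inverse int_cases3 neg_equal_iff_equal nless_le not_less_iff_gr_or_eq of_nat_0_le_iff old.nat.exhaust of_nat_0)
  have "T (inv T y) = y" for y using assms by (simp add: bij_is_surj surj_f_inv_f)
  thus ?thesis by (cases m) (simp_all add: i int_iterate_def nat_add_distrib)
qed

lemma int_iterate_add:
  assumes "bij T"
  shows "int_iterate T (i + j) x = int_iterate T i (int_iterate T j x)"
proof (induction i rule: int_induct[where k = 0])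
  case base
  show ?case by (simp add: int_iterate_0)
next
  case (step1 i)
  thus ?case
    using int_iterate_plus_1[OF assms, of "i + j" x] int_iterate_plus_1[OF assms, of i]
    by (simp add: algebra_simps)
next
  case (step2 i)
  hence "T (int_iterate T (i - 1 + j) x) = T (int_iterate T (i - 1) (int_iterate T j x))"
    using int_iterate_plus_1[OF assms, of "i - 1 + j" x] int_iterate_plus_1[OF assms, of "i - 1"]
    by (simp add: algebra_simps)
  thus ?case using assms by (simp add: bij_is_inj inj_eq)
qed

lemma cocycle_iterate_0: "cocycle_iterate T A 0 x = mat 1"
  by (simp add: cocycle_iterate_def)

lemma cocycle_iterate_plus_1:
  assumes "bij T" and inv: "\<And>x. invertible (A x)"
  shows "cocycle_iterate T A (i + 1) x = A (int_iterate T i x) ** cocycle_iterate T A i x"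
proof (cases "i \<ge> 0")
  case True
  thus ?thesis by (simp add: cocycle_iterate_def nat_add_distrib)
next
  case False
  define m where "m = nat (- i - 1)"
  have i: "i = - int (Suc m)" using False by (simp add: m_def)
  have "backward_iterate T A m x = A (int_iterate T i x) ** backward_iterate T A (Suc m) x"
    unfolding backward_iterate.simps i
    by (simp add: matrix_mul_assoc matrix_inv_right_inverse inv del: of_nat_Suc)
  moreover have "cocycle_iterate T A (i + 1) = backward_iterate T A m"
    by (cases m) (auto simp: cocycle_iterate_def i nat_add_distrib)
  moreover have "cocycle_iterate T A i = backward_iterate T A (Suc m)"
    by (simp add: cocycle_iterate_def i nat_add_distrib)
  ultimately show ?thesis by simp
qed

lemma cocycle_iterate_add:
  assumes "bij T" and inv: "\<And>x. invertible (A x)"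
  shows "cocycle_iterate T A (i + j) x =
    cocycle_iterate T A i (int_iterate T j x) ** cocycle_iterate T A j x"
proof (induction i rule: int_induct[where k = 0])
  case base
  show ?case by (simp add: cocycle_iterate_0)
next
  case (step1 i)
  have "cocycle_iterate T A (i + 1 + j) x =
      A (int_iterate T (i + j) x) ** cocycle_iterate T A (i + j) x"
    using cocycle_iterate_plus_1[OF assms, where i = "i + j" and x = x] by (simp add: algebra_simps)
  thus ?case
    by (simp add: step1.IH int_iterate_add assms(1) cocycle_iterate_plus_1[OF assms] matrix_mul_assoc)
next
  case (step2 i)
  define a where "a = A (int_iterate T (i - 1 + j) x)"
  obtain c where c: "c ** a = mat 1" using inv[of "int_iterate T (i - 1 + j) x"]
    by (auto simp: invertible_def a_def)
  have "a ** cocycle_iterate T A (i - 1 + j) x = cocycle_iterate T A (i + j) x"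
    using cocycle_iterate_plus_1[OF assms, where i = "i - 1 + j" and x = x] by (simp add: a_def algebra_simps)
  also have "\<dots> = a ** (cocycle_iterate T A (i - 1) (int_iterate T j x) ** cocycle_iterate T A j x)"
    using cocycle_iterate_plus_1[OF assms, where i = "i - 1" and x = "int_iterate T j x"]
    by (simp add: step2.IH a_def int_iterate_add assms(1) matrix_mul_assoc)
  finally have "c ** (a ** cocycle_iterate T A (i - 1 + j) x) = c ** (a **
      (cocycle_iterate T A (i - 1) (int_iterate T j x) ** cocycle_iterate T A j x))"
    by simp
  thus ?case unfolding matrix_mul_assoc[of c a] c by simp
qed

section \<open>Complex symplectic matrices\<close>

definition symplectic_unit :: "complex ^ ('l + 'l) ^ ('l::finite + 'l)" where
  "symplectic_unit = block_matrix 0 (- mat 1) (mat 1) 0"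

text \<open>The form is the bilinear one, with the transpose and not the conjugate transpose: the
  Jacobi cocycle preserves it for every complex \<open>z\<close>.\<close>

definition symplectic :: "complex ^ ('l + 'l) ^ ('l::finite + 'l) \<Rightarrow> bool" where
  "symplectic M \<longleftrightarrow> transpose M ** symplectic_unit ** M = symplectic_unit"

lemma transpose_block_matrix:
  "transpose (block_matrix P Q R S) =
    block_matrix (transpose P) (transpose R) (transpose Q) (transpose S)"
  by (simp add: vec_eq_iff transpose_def block_matrix_def split: sum.split)

lemma transpose_uminus: "transpose (- P) = - transpose (P :: complex ^ 'n ^ 'm)"
  by (simp add: transpose_def vec_eq_iff)

lemma uminus_block_matrix:
  fixes P :: "complex ^ 'l ^ 'l"
  shows "- block_matrix P Q R S = block_matrix (- P) (- Q) (- R) (- S)"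
  by (simp add: vec_eq_iff block_matrix_def split: sum.split)

lemma transpose_zero: "transpose (0 :: complex ^ 'n ^ 'm) = 0"
  by (simp add: transpose_def vec_eq_iff)

lemma transpose_symplectic_unit:
  "transpose symplectic_unit = - (symplectic_unit :: complex ^ ('l + 'l) ^ ('l::finite + 'l))"
  by (simp add: symplectic_unit_def transpose_block_matrix uminus_block_matrix transpose_uminus
      transpose_zero)

lemma symplectic_unit_orthogonal: "transpose symplectic_unit ** symplectic_unit = mat 1"
  unfolding transpose_symplectic_unit
  by (simp add: symplectic_unit_def uminus_block_matrix block_matrix_mult matrix_mul_zero
      matrix_mul_minus_left matrix_mul_minus_right block_matrix_one)

lemma norm_symplectic_unit:
  fixes v :: "complex ^ ('l::finite + 'l)"
  shows "norm (symplectic_unit *v v) = norm v" "norm (transpose symplectic_unit *v v) = norm v"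
proof -
  have *: "(\<Sum>k\<in>UNIV. h k) = (\<Sum>a\<in>UNIV. h (Inl a)) + (\<Sum>a\<in>UNIV. h (Inr a))"
    for h :: "'l + 'l \<Rightarrow> 'b::comm_monoid_add"
    by (simp add: UNIV_Plus_UNIV[symmetric] sum.Plus del: UNIV_Plus_UNIV)
  have comp: "(symplectic_unit *v v) $ Inl a = - v $ Inr a" "(symplectic_unit *v v) $ Inr a = v $ Inl a"
    for a
    by (simp_all add: symplectic_unit_def block_matrix_def matrix_vector_mult_def * mat_def
        if_distrib if_distribR cong: if_cong)
  show 1: "norm (symplectic_unit *v v) = norm v"
    by (simp add: norm_vec_def L2_set_def * comp add.commute)
  have "transpose symplectic_unit *v v = - (symplectic_unit *v v)"
    unfolding transpose_symplectic_unit by (simp add: vec_eq_iff matrix_vector_mult_def sum_negf)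
  thus "norm (transpose symplectic_unit *v v) = norm v" using 1 by simp
qed

lemma symplectic_mult:
  assumes "symplectic M" "symplectic N"
  shows "symplectic (M ** N)"
proof -
  have "transpose (M ** N) ** symplectic_unit ** (M ** N) =
      transpose N ** (transpose M ** symplectic_unit ** M) ** N"
    by (simp only: matrix_transpose_mul matrix_mul_assoc)
  thus ?thesis using assms by (simp add: symplectic_def)
qed

lemma symplectic_left_inverse:
  assumes "symplectic M"
  shows "transpose symplectic_unit ** transpose M ** symplectic_unit ** M = mat 1"
  using assms symplectic_unit_orthogonal
  by (simp add: symplectic_def matrix_mul_assoc[symmetric])

lemma symplectic_inverse_eq:
  assumes "symplectic M" "M ** N = mat 1"
  shows "N = transpose symplectic_unit ** transpose M ** symplectic_unit"
proof -
  have "transpose symplectic_unit ** transpose M ** symplectic_unit ** M ** N = N"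
    using symplectic_left_inverse[OF assms(1)] by simp
  thus ?thesis using assms(2) by (simp add: matrix_mul_assoc[symmetric])
qed

lemma symplectic_right_factor:
  assumes "symplectic M" "symplectic (M ** N)"
  shows "symplectic N"
proof -
  have "transpose (M ** N) ** symplectic_unit ** (M ** N) =
      transpose N ** (transpose M ** symplectic_unit ** M) ** N"
    by (simp only: matrix_transpose_mul matrix_mul_assoc)
  thus ?thesis using assms by (simp add: symplectic_def)
qed

definition cnj_vec :: "complex ^ 'n \<Rightarrow> complex ^ 'n" where
  "cnj_vec v = (\<chi> i. cnj (v $ i))"

lemma norm_cnj_vec: "norm (cnj_vec v) = norm v"
  by (simp add: cnj_vec_def norm_vec_def)

text \<open>Up to the isometries given by conjugation and the symplectic unit \<open>J\<close>, the dual of a symplectic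
  matrix is the matrix itself: \<open>M\<inverse> = J\<^sup>T M\<^sup>T J\<close>. The vector to which \<open>M\<close> is applied on the right-hand
  side does not depend on \<open>M\<close>, so one vector serves forward and backward iterates at once.\<close>

lemma norm_cadjoint_symplectic_inverse:
  assumes "symplectic M" "M ** N = mat 1"
  shows "norm (cadjoint N *v r) = norm (M *v (symplectic_unit *v cnj_vec r))"
proof -
  let ?c = cnj_vec
  have "cadjoint N *v r = ?c (transpose N *v ?c r)"
    by (simp add: vec_eq_iff cnj_vec_def cadjoint_def transpose_def matrix_vector_mult_def del: transpose_matrix_vector)
  moreover have "transpose N = transpose symplectic_unit ** M ** symplectic_unit"
    using symplectic_inverse_eq[OF assms] by (simp add: matrix_transpose_mul matrix_mul_assoc)
  hence "transpose N *v ?c r = transpose symplectic_unit *v (M *v (symplectic_unit *v ?c r))"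
    by (simp only: matrix_vector_mul_assoc matrix_mul_assoc)
  ultimately show ?thesis by (simp only: norm_cnj_vec norm_symplectic_unit)
qed

lemma symplectic_Jacobi_cocycle:
  assumes "transpose (D (T x)) = D (T x)" "transpose (V (T x)) = V (T x)" "invertible (D (T x))"
  shows "symplectic (Jacobi_cocycle T D V z x)"
proof -
  define c where "c = complex_matrix (D (T x))"
  define b where "b = complex_matrix (matrix_inv (D (T x)))"
  define y where "y = mat z - complex_matrix (V (T x))"
  have cb: "c ** b = mat 1"
    unfolding c_def b_def
    by (simp add: complex_matrix_mult[symmetric] complex_matrix_one matrix_inv_right_inverse assms)
  hence bc: "b ** c = mat 1" using matrix_left_right_inverse by blast
  have tc: "transpose c = c"
    using assms(1) by (simp add: c_def complex_matrix_def vec_eq_iff transpose_def)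
  have "c ** transpose b = mat 1" using arg_cong[OF bc, of transpose]
    by (simp add: matrix_transpose_mul tc)
  hence "b ** c ** transpose b = b" by (simp add: matrix_mul_assoc[symmetric])
  hence tb: "transpose b = b" by (simp add: bc)
  have ty: "transpose y = y"
    using assms(2) by (auto simp: y_def complex_matrix_def vec_eq_iff transpose_def mat_def)
  have "y ** b ** c = y" by (simp add: matrix_mul_assoc[symmetric] bc)
  moreover have "c ** (b ** y) = y" by (simp add: matrix_mul_assoc cb)
  ultimately show ?thesis
    unfolding symplectic_def Jacobi_cocycle_def c_def[symmetric] b_def[symmetric] y_def[symmetric]
      symplectic_unit_def
    by (simp add: transpose_block_matrix block_matrix_mult matrix_transpose_mul tb tc ty
        transpose_uminus transpose_zero matrix_mul_zero matrix_mul_minus_left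
        matrix_mul_minus_right cb bc)
qed

section \<open>Symplectic cocycles\<close>

locale symplectic_cocycle =
  fixes T :: "'w::metric_space \<Rightarrow> 'w" and A :: "'w \<Rightarrow> complex ^ ('l::finite + 'l) ^ ('l + 'l)"
  assumes compact_space: "compact (UNIV :: 'w set)"
    and cocycle: "SL_cocycle T A"
    and symplectic_A: "symplectic (A x)"
begin

abbreviation \<theta> where "\<theta> \<equiv> int_iterate T"
abbreviation \<Phi> where "\<Phi> \<equiv> cocycle_iterate T A"

lemma homeomorphism_T: obtains R where "continuous_on UNIV T" "continuous_on UNIV R"
    "\<And>x. R (T x) = x" "\<And>x. T (R x) = x"
proof -
  obtain R where "homeomorphism UNIV UNIV T R"
    using cocycle by (auto simp: SL_cocycle_def is_homeomorphism_def)
  thus ?thesis by (intro that[of R]) (auto simp: homeomorphism_def)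
qed

lemma bij_T: "bij T"
  using homeomorphism_T by (metis bij_betw_def injI surjI)

lemma invertible_A: "invertible (A x)"
  using cocycle by (simp add: SL_cocycle_def invertible_det_nz)

lemma iterate_plus_1: "\<Phi> (i + 1) x = A (\<theta> i x) ** \<Phi> i x"
  by (rule cocycle_iterate_plus_1[OF bij_T invertible_A])

lemma continuous_base: "continuous_on UNIV (\<theta> i)"
proof -
  obtain R where R: "continuous_on UNIV T" "continuous_on UNIV R" "\<And>x. R (T x) = x" "\<And>x. T (R x) = x"
    using homeomorphism_T by metis
  have comp: "continuous_on UNIV (\<lambda>x. g (f x))"
    if "continuous_on UNIV g" "continuous_on UNIV f" for f g :: "'w \<Rightarrow> 'w"
    using continuous_on_compose2[OF that] by simp
  show ?thesis
  proof (induction i rule: int_induct[where k = 0])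
    case base
    show ?case by (simp add: int_iterate_def)
  next
    case (step1 i)
    have "\<theta> (i + 1) = (\<lambda>x. T (\<theta> i x))" using int_iterate_plus_1[OF bij_T] by blast
    thus ?case using comp[OF R(1) step1.IH] by simp
  next
    case (step2 i)
    have "\<theta> (i - 1) x = R (\<theta> i x)" for x
      using int_iterate_plus_1[OF bij_T, of "i - 1" x] R(3) by simp
    hence "\<theta> (i - 1) = (\<lambda>x. R (\<theta> i x))" by blast
    thus ?case using comp[OF R(2) step2.IH] by simp
  qed
qed

lemma continuous_iterate: "continuous_on UNIV (\<Phi> i)"
proof -
  have "continuous_on UNIV A" using cocycle by (simp add: SL_cocycle_def)
  hence A: "continuous_on UNIV (\<lambda>x. A (\<theta> i x))" for i
    using continuous_on_compose2[OF _ continuous_base] by auto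
  show ?thesis
  proof (induction i rule: int_induct[where k = 0])
    case base
    have "\<Phi> 0 = (\<lambda>x. mat 1)" by (rule ext) (rule cocycle_iterate_0)
    thus ?case by simp
  next
    case (step1 i)
    have "\<Phi> (i + 1) = (\<lambda>x. A (\<theta> i x) ** \<Phi> i x)" using iterate_plus_1 by blast
    thus ?case using continuous_on_matrix_mult[OF A step1.IH] by simp
  next
    case (step2 i)
    let ?N = "\<lambda>x. transpose symplectic_unit ** transpose (A (\<theta> (i - 1) x)) ** symplectic_unit"
    have "\<Phi> (i - 1) x = ?N x ** \<Phi> i x" for x
      using iterate_plus_1[of "i - 1" x] symplectic_left_inverse[OF symplectic_A[of "\<theta> (i - 1) x"]]
      by (simp add: matrix_mul_assoc)
    hence "\<Phi> (i - 1) = (\<lambda>x. ?N x ** \<Phi> i x)" by blast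
    moreover have "continuous_on UNIV (\<lambda>x. transpose (A (\<theta> (i - 1) x)))"
      unfolding transpose_def by (intro continuous_on_vec_lambda continuous_intros A)
    hence "continuous_on UNIV (\<lambda>x. ?N x ** \<Phi> i x)"
      by (intro continuous_on_matrix_mult continuous_on_const step2.IH)
    ultimately show ?case by simp
  qed
qed

lemma symplectic_iterate: "symplectic (\<Phi> i x)"
proof (induction i rule: int_induct[where k = 0])
  case base
  show ?case by (simp add: cocycle_iterate_0 symplectic_def)
next
  case (step1 i)
  thus ?case by (simp add: iterate_plus_1 symplectic_mult symplectic_A)
next
  case (step2 i)
  thus ?case
    using symplectic_right_factor[OF symplectic_A] iterate_plus_1[of "i - 1" x] by simp
qed

sublocale linear_flow \<theta> \<Phi>
proof
  show "\<Phi> (i + j) x = \<Phi> i (\<theta> j x) ** \<Phi> j x" for i j x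
    by (rule cocycle_iterate_add[OF bij_T invertible_A])
  show "\<theta> (i + j) x = \<theta> i (\<theta> j x)" for i j x by (rule int_iterate_add[OF bij_T])
qed (simp_all add: cocycle_iterate_0 continuous_iterate compact_space)

lemma step: "\<Phi> 1 x = A x" "\<theta> 1 x = T x"
  using iterate_plus_1[of 0 x] int_iterate_plus_1[OF bij_T, of 0 x]
  by (simp_all add: cocycle_iterate_0 int_iterate_0)

text \<open>Growth is inherited by the dual flow, because symplectic iterates are isometrically conjugate to
  their duals.\<close>

lemma balanced_growing_flow_of_UG:
  assumes "(T, A) \<in> UG"
  shows "\<exists>b lam. balanced_growing_flow \<theta> \<Phi> b lam"
proof -
  obtain \<beta> lam where \<beta>: "\<beta> > 0" and lam: "lam > 1" and
    ug: "\<And>x v. v \<noteq> 0 \<Longrightarrow> (\<forall>n\<ge>1. \<beta> * lam ^ n * norm v \<le> norm (\<Phi> (int n) x *v v)) \<or>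
        (\<forall>n\<ge>1. \<beta> * lam ^ n * norm v \<le> norm (\<Phi> (- int n) x *v v))"
    using assms unfolding UG_def by auto
  define b where "b = min \<beta> 1"
  have b: "0 < b" "b \<le> 1" "b \<le> \<beta>" using \<beta> by (auto simp: b_def)
  have extend: "b * lam ^ n * norm v \<le> norm (f n)"
    if "\<forall>n\<ge>1. \<beta> * lam ^ n * norm v \<le> norm (f n)" "f 0 = v" for f n and v :: "complex ^ ('l + 'l)"
  proof (cases "n \<ge> 1")
    case True
    have "b * lam ^ n * norm v \<le> \<beta> * lam ^ n * norm v"
      using b lam by (intro mult_right_mono) auto
    thus ?thesis using that(1) True order_trans by blast
  next
    case False
    hence "n = 0" by simp
    thus ?thesis using that(2) b mult_right_mono[OF b(2) norm_ge_zero[of v]] by simp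
  qed
  have growth: "(\<forall>n. b * lam ^ n * norm v \<le> norm (\<Phi> (int n) x *v v)) \<or>
      (\<forall>n. b * lam ^ n * norm v \<le> norm (\<Phi> (- int n) x *v v))" for x v
  proof (cases "v = 0")
    case False
    from ug[OF this, of x] show ?thesis
    proof
      assume *: "\<forall>n\<ge>1. \<beta> * lam ^ n * norm v \<le> norm (\<Phi> (int n) x *v v)"
      show ?thesis using extend[OF *] by (simp add: flow_0)
    next
      assume *: "\<forall>n\<ge>1. \<beta> * lam ^ n * norm v \<le> norm (\<Phi> (- int n) x *v v)"
      show ?thesis using extend[OF *] by (simp add: flow_0)
    qed
  qed simp
  have dual: "b * norm r \<le> max (norm (cadjoint (\<Phi> (- int n) (\<theta> (int n) x)) *v r))
      (norm (cadjoint (\<Phi> (int n) (\<theta> (- int n) x)) *v r))" for r n x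
  proof -
    define w where "w = symplectic_unit *v cnj_vec r"
    have w: "norm w = norm r" by (simp add: w_def norm_symplectic_unit norm_cnj_vec)
    have dual: "norm (cadjoint (\<Phi> (- i) (\<theta> i x)) *v r) = norm (\<Phi> i x *v w)" for i
      unfolding w_def by (rule norm_cadjoint_symplectic_inverse[OF symplectic_iterate flow_inverse])
    have "b * norm r \<le> b * lam ^ n * norm w"
      unfolding w using b lam by (intro mult_right_mono) auto
    thus ?thesis
      using growth[of w x] dual[of "int n"] dual[of "- int n"]
      by (auto simp: le_max_iff_disj dest!: spec[of _ n])
  qed
  have "balanced_growing_flow \<theta> \<Phi> b lam"
    by unfold_locales (use b lam growth dual in auto)
  thus ?thesis by blast
qed

lemma UH_of_UG:
  assumes "(T, A) \<in> UG"
  shows "(T, A) \<in> UH"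
proof -
  obtain b lam where "balanced_growing_flow \<theta> \<Phi> b lam"
    using balanced_growing_flow_of_UG[OF assms] by blast
  then interpret g: balanced_growing_flow \<theta> \<Phi> b lam .
  obtain K where "closed_splitting g.stable g.unstable K"
    using g.closed_splitting by blast
  then interpret s: closed_splitting g.stable g.unstable K .
  have "continuous_Whitney_splitting g.stable g.unstable"
    unfolding continuous_Whitney_splitting_def
  proof (intro conjI allI)
    show "continuous_subbundle g.stable" by (rule s.continuous_subbundle_S)
    show "continuous_subbundle g.unstable"
      by (rule closed_splitting.continuous_subbundle_S[OF s.swap])
    show "{v + w |v w. v \<in> g.stable x \<and> w \<in> g.unstable x} = UNIV" for x
    proof (rule UNIV_eq_I[symmetric], intro CollectI)
      fix v
      obtain a where "a \<in> g.stable x" "v - a \<in> g.unstable x" using g.decomposition by blast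
      thus "\<exists>a c. v = a + c \<and> a \<in> g.stable x \<and> c \<in> g.unstable x"
        by (intro exI[of _ a] exI[of _ "v - a"]) simp
    qed
    show "g.stable x \<inter> g.unstable x = {0}" for x
      using g.trivial_intersection vec.subspace_0[OF s.subspace_S]
        vec.subspace_0[OF s.subspace_U] by auto
  qed
  moreover have "A (\<theta> j x) *v v \<in> g.unstable (\<theta> (j + 1) x)" if "v \<in> g.unstable (\<theta> j x)" for j x v
    using g.unstable_invariant[OF that, of 1] by (simp add: step int_iterate_plus_1[OF bij_T])
  moreover have "A (\<theta> j x) *v v \<in> g.stable (\<theta> (j + 1) x)" if "v \<in> g.stable (\<theta> j x)" for j x v
    using stable_space_invariant[OF that, of 1] by (simp add: step int_iterate_plus_1[OF bij_T])
  moreover have "norm (\<Phi> (- int n) x *v v) \<le> 1 / b * lam powi (- int n) * norm v"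
    if "v \<in> g.unstable x" for v x n
    using g.unstable_decay[OF that, of n] g.b g.lam
    by (simp add: power_int_minus field_simps)
  moreover have "norm (\<Phi> (int n) x *v v) \<le> 1 / b * lam powi (- int n) * norm v"
    if "v \<in> g.stable x" for v x n
    using g.stable_space_decay[OF that, of n] g.b g.lam
    by (simp add: power_int_minus field_simps)
  moreover have "1 / b > 0" using g.b by simp
  ultimately show ?thesis
    unfolding UH_def using cocycle g.lam by blast
qed

text \<open>Hyperbolicity is stated for orbits that decay and for forward invariant bundles. Backward
  invariance turns the decay into expansion along the same orbits in the opposite direction of time, so
  that \<open>growth_of_splitting\<close> applies.\<close>

lemma UG_of_UH:
  assumes "(T, A) \<in> UH"
  shows "(T, A) \<in> UG"
proof -
  obtain S U C lam where split: "continuous_Whitney_splitting S U"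
    and inv: "\<And>x j v w. v \<in> U (\<theta> j x) \<Longrightarrow> w \<in> S (\<theta> j x) \<Longrightarrow>
        A (\<theta> j x) *v v \<in> U (\<theta> (j + 1) x) \<and> A (\<theta> j x) *v w \<in> S (\<theta> (j + 1) x)"
    and C: "C > 0" and lam: "lam > 1"
    and decay: "\<And>x v w n. v \<in> U x \<Longrightarrow> w \<in> S x \<Longrightarrow> n \<ge> 1 \<Longrightarrow>
        norm (\<Phi> (- int n) x *v v) \<le> C * lam powi (- int n) * norm v \<and>
        norm (\<Phi> (int n) x *v w) \<le> C * lam powi (- int n) * norm w"
    using assms unfolding UH_def by blast
  have sub: "vec.subspace (S x)" "vec.subspace (U x)" for x
    using split unfolding continuous_Whitney_splitting_def continuous_subbundle_def
    by (metis vec.subspace_span)+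
  hence zero: "0 \<in> S x" "0 \<in> U x" for x by (auto intro: vec.subspace_0)
  have sum: "\<exists>s\<in>S x. \<exists>u\<in>U x. v = s + u" for x v
  proof -
    have "v \<in> {s + u |s u. s \<in> S x \<and> u \<in> U x}"
      using split by (simp add: continuous_Whitney_splitting_def)
    thus ?thesis by blast
  qed
  have disjoint: "v = 0" if "v \<in> S x" "v \<in> U x" for v x
    using that split unfolding continuous_Whitney_splitting_def by blast
  have forward: "v \<in> S x \<Longrightarrow> A x *v v \<in> S (T x)" "v \<in> U x \<Longrightarrow> A x *v v \<in> U (T x)" for v x
    using inv[of 0 0 x v] inv[of v 0 x 0] zero by (simp_all add: int_iterate_0 step)
  \<comment> \<open>\<open>A\<close> is injective and maps the two summands into independent subspaces, so the part of \<open>v\<close>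
    in \<open>F\<close> cannot contribute to an image in \<open>E\<close>.\<close>
  have pull_back: "v \<in> E x"
    if Av: "A x *v v \<in> E (T x)"
      and EF: "\<And>x v. \<exists>e\<in>E x. \<exists>f\<in>F x. v = e + f" "\<And>x v. v \<in> E x \<Longrightarrow> v \<in> F x \<Longrightarrow> v = 0"
      and sub_E: "\<And>x. vec.subspace (E x)"
      and fw: "\<And>v x. v \<in> E x \<Longrightarrow> A x *v v \<in> E (T x)" "\<And>v x. v \<in> F x \<Longrightarrow> A x *v v \<in> F (T x)"
    for E F v x
  proof -
    obtain e f where ef: "e \<in> E x" "f \<in> F x" "v = e + f" using EF(1) by blast
    hence "A x *v f = A x *v v - A x *v e" by (simp add: matrix_vector_right_distrib)
    hence "A x *v f \<in> E (T x)" using vec.subspace_diff[OF sub_E Av fw(1)[OF ef(1)]] by simp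
    hence "A x *v f = 0" using EF(2) fw(2)[OF ef(2)] by blast
    hence "f = 0" using invertible_A[of x] matrix_left_invertible_ker[of "A x"]
      by (metis invertible_left_inverse)
    thus ?thesis using ef by simp
  qed
  have backward: "v \<in> S x" if "A x *v v \<in> S (T x)" for v x
    using that sum disjoint sub(1) forward by (rule pull_back)
  have sum': "\<exists>u\<in>U x. \<exists>s\<in>S x. v = u + s" for x v
    using sum[of x v] by (metis add.commute)
  have backward': "v \<in> U x" if "A x *v v \<in> U (T x)" for v x
    using that sum' disjoint sub(2) forward(2,1) by (rule pull_back)
  have invariant: "\<Phi> i x *v v \<in> E (\<theta> i x)"
    if "v \<in> E x" and fw: "\<And>v x. v \<in> E x \<Longrightarrow> A x *v v \<in> E (T x)"
      and bw: "\<And>v x. A x *v v \<in> E (T x) \<Longrightarrow> v \<in> E x" for E v i x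
  proof (induction i rule: int_induct[where k = 0])
    case base
    show ?case using that(1) by (simp add: flow_0 int_iterate_0)
  next
    case (step1 i)
    thus ?case
      using fw[OF step1.IH] by (simp add: iterate_plus_1 int_iterate_plus_1[OF bij_T] matrix_vector_mul_assoc)
  next
    case (step2 i)
    have "\<Phi> i x *v v = A (\<theta> (i - 1) x) *v (\<Phi> (i - 1) x *v v)" "\<theta> i x = T (\<theta> (i - 1) x)"
      using iterate_plus_1[of "i - 1" x] int_iterate_plus_1[OF bij_T, of "i - 1" x]
      by (simp_all add: matrix_vector_mul_assoc)
    thus ?case using bw step2.IH by simp
  qed
  \<comment> \<open>Raising \<open>C\<close> to at least \<open>1\<close> extends the estimates to time \<open>0\<close>.\<close>
  define C' where "C' = max C 1"
  have C': "C' > 0" "C \<le> C'" "1 \<le> C'" by (auto simp: C'_def)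
  have weaken: "lam ^ n * norm w \<le> C' * norm v"
    if "n \<ge> 1 \<Longrightarrow> norm w \<le> C * lam powi (- int n) * norm v" "n = 0 \<Longrightarrow> w = v"
    for n and v w :: "complex ^ ('l + 'l)"
  proof (cases "n = 0")
    case True
    thus ?thesis using that(2) mult_right_mono[OF C'(3) norm_ge_zero[of v]] by simp
  next
    case False
    hence "lam ^ n * norm w \<le> C * norm v"
      using that(1) lam by (simp add: power_int_minus field_simps)
    thus ?thesis using mult_right_mono[OF C'(2) norm_ge_zero[of v]] by linarith
  qed
  have S_inv: "\<Phi> i x *v v \<in> S (\<theta> i x)" if "v \<in> S x" for i x v
    using that forward(1) backward by (rule invariant)
  have U_inv: "\<Phi> i x *v v \<in> U (\<theta> i x)" if "v \<in> U x" for i x v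
    using that forward(2) backward' by (rule invariant)
  have expand: "lam ^ n * norm u \<le> C' * norm (\<Phi> (int n) x *v u)" if "u \<in> U x" for x u n
    using decay[OF U_inv[OF that, of "int n"] zero(1), of n]
    by (intro weaken) (simp_all add: flow_minus_cancel flow_0)
  have contract: "lam ^ n * norm s \<le> C' * norm (\<Phi> (- int n) x *v s)" if "s \<in> S x" for x s n
    using decay[OF zero(2) S_inv[OF that, of "- int n"], of n] flow_minus_cancel[of "- int n" x s]
    by (intro weaken) (simp_all add: flow_0)
  obtain b where "b > 0" and "\<And>x v. (\<forall>n. b * lam ^ n * norm v \<le> norm (\<Phi> (int n) x *v v)) \<or>
    (\<forall>n. b * lam ^ n * norm v \<le> norm (\<Phi> (- int n) x *v v))"
    using growth_of_splitting[OF C'(1) lam sum expand contract S_inv U_inv] by blast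
  thus ?thesis
    unfolding UG_def using cocycle lam by blast
qed

end

theorem theorem1p6:
  fixes T :: "'w::metric_space \<Rightarrow> 'w"
    and D V :: "'w \<Rightarrow> real ^ 'l ^ 'l"
    and z :: complex
  assumes "compact (UNIV :: 'w set)"
    and "is_homeomorphism T"
    and "continuous_on UNIV D" and "continuous_on UNIV V"
    and "\<And>\<omega>. transpose (D \<omega>) = D \<omega>" and "\<And>\<omega>. transpose (V \<omega>) = V \<omega>"
    and "\<And>\<omega>. invertible (D \<omega>)"
  shows "(T, Jacobi_cocycle T D V z) \<in> UG \<longleftrightarrow> (T, Jacobi_cocycle T D V z) \<in> UH"
proof -
  interpret symplectic_cocycle T "Jacobi_cocycle T D V z"
    by unfold_locales
      (intro assms(1) SL_cocycle_Jacobi_cocycle symplectic_Jacobi_cocycle assms)+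
  show ?thesis using UH_of_UG UG_of_UH by blast
qed

end
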